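(* Let $a<b$, $p\geqslant 1$, and let $X=X(t)$ and $Y=Y(t)$, $t\in[a,b]$, be real-valued stochastic processes on a common probability space. Let $f=f(s,t)$, $a\leqslant s\leqslant t\leqslant b$, be a real-valued function that is non-increasing in $s$, non-decreasing in $t$, satisfies $f(t,t)=0$ for all $t$, and is such that $$\|(Y(u)-Y(s))\,(X(t)-X(u))\|_p\leqslant f(s,t)\qquad\text{for all } a\leqslant s<u<t\leqslant b.$$ Suppose that $I_f(a,b)<\infty$. Then $\int_a^b Y\,dX$ exists as a limit in $L_p$ of the forward integral sums $\sum_{i=1}^n Y(t_{i-1})\,(X(t_i)-X(t_{i-1}))$. Moreover, for any partition $a=t_0<t_1<\ldots<t_n=b$, $$\Big\|\int_a^bY\,dX-\sum_{i=1}^nY(t_{i-1})\,(X(t_{i})-X(t_{i-1}))\Big\|_p\leqslant 92\, I_g(t_0,t_n),$$ where $g(s,t)=f(s,t)\,\mathbf 1(t<s+3d)$ for $s\leqslant t$, and $d=\max\{t_i-t_{i-1}:1\leqslant i\leqslant n\}$ is the mesh of $\{t_i\}_{i=0}^n$.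
   Context: $\|\xi\|_p=(\mathbb E|\xi|^p)^{1/p}$ is the $L_p$-norm, and $\mathbf 1(\cdot)$ is the indicator. For a non-negative function $h=h(s,t)$ of $s\leqslant t$ and $\alpha<\beta$, $$I_h(\alpha,\beta)=\int_{\alpha}^{\beta}\int_s^{\beta} \frac{h(s,t)}{(t-s)^2}\,dt\,ds+\int_{\alpha}^{\beta}\frac{h(\alpha,t)}{t-\alpha}\,dt+\int_{\alpha}^{\beta}\frac{h(s,\beta)}{\beta-s}\,ds+h(\alpha,\beta)\in[0,\infty].$$ Limits of integral sums are taken over all sequences of partitions of $[a,b]$ with mesh tending to zero. That the integral exists as a limit in $L_p$ means that there is a random variable, denoted $\int_a^bY\,dX$, such that the $L_p$-norm of its difference with the integral sums tends to $0$ along every such sequence of partitions. *)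

theory Defs
  imports "HOL-Probability.Probability"
begin

(* The L_p-norm takes values in [0,\<infinity>] (p a positive real), so that a finite bound on it
   includes the p-integrability of the random variable. *)
definition Lp_norm :: "'w measure \<Rightarrow> real \<Rightarrow> ('w \<Rightarrow> real) \<Rightarrow> ennreal" where
  "Lp_norm M p \<xi> =
     (let m = (\<integral>\<^sup>+ \<omega>. ennreal (\<bar>\<xi> \<omega>\<bar> powr p) \<partial>M)
      in if m = \<infinity> then \<infinity> else ennreal (enn2real m powr (1 / p)))"

(* Meant for functions that are non-negative on \<alpha> \<le> s \<le> t \<le> \<beta>; only the values of h on that
   triangle enter.  Open intervals keep the zero denominators out of the integrals. *)
definition I_fun :: "(real \<Rightarrow> real \<Rightarrow> real) \<Rightarrow> real \<Rightarrow> real \<Rightarrow> ennreal" where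
  "I_fun h \<alpha> \<beta> =
     (\<integral>\<^sup>+ s \<in> {\<alpha><..<\<beta>}. (\<integral>\<^sup>+ t \<in> {s<..<\<beta>}. ennreal (h s t / (t - s)\<^sup>2) \<partial>lborel) \<partial>lborel)
     + (\<integral>\<^sup>+ t \<in> {\<alpha><..<\<beta>}. ennreal (h \<alpha> t / (t - \<alpha>)) \<partial>lborel)
     + (\<integral>\<^sup>+ s \<in> {\<alpha><..<\<beta>}. ennreal (h s \<beta> / (\<beta> - s)) \<partial>lborel)
     + ennreal (h \<alpha> \<beta>)"

(* A partition is a number n of subintervals together with the points t 0, ..., t n;
   the values of t beyond n are irrelevant. *)
definition is_partition :: "real \<Rightarrow> real \<Rightarrow> nat \<Rightarrow> (nat \<Rightarrow> real) \<Rightarrow> bool" where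
  "is_partition a b n t \<longleftrightarrow> t 0 = a \<and> t n = b \<and> (\<forall>i\<in>{1..n}. t (i - 1) < t i)"

definition mesh :: "nat \<Rightarrow> (nat \<Rightarrow> real) \<Rightarrow> real" where
  "mesh n t = Max ((\<lambda>i. t i - t (i - 1)) ` {1..n})"

definition forward_sum ::
  "(real \<Rightarrow> 'w \<Rightarrow> real) \<Rightarrow> (real \<Rightarrow> 'w \<Rightarrow> real) \<Rightarrow> nat \<Rightarrow> (nat \<Rightarrow> real) \<Rightarrow> 'w \<Rightarrow> real" where
  "forward_sum Y X n t \<omega> = (\<Sum>i=1..n. Y (t (i - 1)) \<omega> * (X (t i) \<omega> - X (t (i - 1)) \<omega>))"

(* Z is (a version of) the integral of Y with respect to X over [a,b]; it is determined only
   up to almost sure equality, hence a predicate rather than a function. *)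
definition is_Lp_forward_integral ::
  "'w measure \<Rightarrow> real \<Rightarrow> (real \<Rightarrow> 'w \<Rightarrow> real) \<Rightarrow> (real \<Rightarrow> 'w \<Rightarrow> real) \<Rightarrow> real \<Rightarrow> real
     \<Rightarrow> ('w \<Rightarrow> real) \<Rightarrow> bool" where
  "is_Lp_forward_integral M p Y X a b Z \<longleftrightarrow>
     Z \<in> borel_measurable M \<and>
     (\<forall>n t. (\<forall>k. is_partition a b (n k) (t k)) \<and> (\<lambda>k. mesh (n k) (t k)) \<longlonglongrightarrow> 0 \<longrightarrow>
        (\<lambda>k. Lp_norm M p (\<lambda>\<omega>. Z \<omega> - forward_sum Y X (n k) (t k) \<omega>)) \<longlonglongrightarrow> 0)"

end

theory Submission
  imports Defs
begin

text \<open>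
  Deleting an interior point \<open>u\<close> with neighbours \<open>l < u < r\<close> from a partition changes the forward sum by
  exactly \<open>(Y u - Y l) * (X r - X u)\<close>, whose norm is at most \<open>f l r\<close>.  A partition \<open>\<pi>\<close> is
  recovered from a refinement by deleting the additional points one at a time, so everything comes
  down to choosing an order of deletion for which the total cost \<open>\<Sum>u. f (l u) (r u)\<close> is small.

  Always delete the point whose current gap \<open>r - l\<close> is smallest (\<open>greedy_thinning\<close>).  Compare the
  cost \<open>f l r\<close>, with \<open>h = r - l\<close>, with an integral over the square \<open>(l - h, l) \<times> (r, r + h)\<close>: there
  \<open>f s t \<ge> f l r\<close> by monotonicity and \<open>t - s < 3 h\<close>, so \<open>f l r\<close> is at most \<open>9\<close> times the integral of
  \<open>f s t / (t - s)^2\<close> over the square.  A given point \<open>(s, t)\<close> lies in at most six of these squares: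
  when the first of them arises, every deletable point of \<open>(s, t)\<close> has a gap wider than \<open>(t - s) / 3\<close>,
  and so each third of \<open>(s, t)\<close> contains at most two such points.  All costs together are therefore at
  most \<open>54\<close> times the integral of \<open>f s t / (t - s)^2\<close> over the part \<open>t < s + 3 d\<close> of the plane, since
  the gaps are at most the mesh \<open>d\<close> of \<open>\<pi>\<close>.

  Squares near the end points leave \<open>[a, b]\<close>, which is repaired by extending \<open>f\<close> to the value
  \<open>f (max s a) (min t b)\<close>.  Integrating out the coordinates that lie outside turns the plane integral
  of the extension into the four terms of \<open>I_fun\<close> (\<open>plane_integral_le_I_fun\<close>): this is the origin of
  the boundary terms.  As \<open>f\<close> is monotone in each variable but possibly not jointly Borel, the
  extension is replaced by the supremum of its values on a countable grid, which is Borel, lies below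
  the extension, and still dominates \<open>f l r\<close> on the square of \<open>(l, r)\<close>.

  By dominated convergence the plane integral over \<open>t < s + 3 d\<close> tends to \<open>0\<close> with \<open>d\<close>.  Any two
  partitions have a common refinement, so integral sums of small mesh are close to each other in
  \<open>L\<^sub>p\<close>; completeness of \<open>L\<^sub>p\<close> gives a limit \<open>Z\<close> along the uniform partitions, and passing to the
  limit in the comparison bounds the distance from \<open>Z\<close> to every integral sum.
\<close>

section \<open>The space of p-integrable random variables\<close>

text \<open>Translates norm bounds into bounds on integrals, so that the case distinction in the definition of
  the norm and the outer root disappear from the arguments below.\<close>

lemma Lp_norm_le_iff:
  assumes "p > 0" "c \<ge> 0"
  shows "Lp_norm M p \<xi> \<le> ennreal c \<longleftrightarrow>
         (\<integral>\<^sup>+ \<omega>. ennreal (\<bar>\<xi> \<omega>\<bar> powr p) \<partial>M) \<le> ennreal (c powr p)"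
proof (cases "(\<integral>\<^sup>+ \<omega>. ennreal (\<bar>\<xi> \<omega>\<bar> powr p) \<partial>M)")
  case (real x)
  have "x powr (1 / p) \<le> c \<longleftrightarrow> x \<le> c powr p"
  proof
    assume "x powr (1 / p) \<le> c"
    then have "(x powr (1 / p)) powr p \<le> c powr p"
      using assms by (intro powr_mono2) auto
    then show "x \<le> c powr p" using assms real by (simp add: powr_powr)
  next
    assume "x \<le> c powr p"
    then have "x powr (1 / p) \<le> (c powr p) powr (1 / p)"
      using assms real by (intro powr_mono2) auto
    then show "x powr (1 / p) \<le> c" using assms by (simp add: powr_powr)
  qed
  then show ?thesis using real assms by (simp add: Lp_norm_def)
qed (simp add: Lp_norm_def top_unique)

text \<open>Convexity of \<open>x powr p\<close> at the convex combination \<open>(u + v) / (A + B)\<close> of \<open>u / A\<close> and \<open>v / B\<close>.  With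
  norms in place of \<open>A\<close> and \<open>B\<close> this is Minkowski's inequality before integration.\<close>

lemma powr_add_le_convex_combination:
  fixes u v A B p :: real
  assumes "p \<ge> 1" "A > 0" "B > 0" "u \<ge> 0" "v \<ge> 0"
  shows "(u + v) powr p \<le> (A + B) powr p *
           (A / (A + B) * (u powr p / A powr p) + B / (A + B) * (v powr p / B powr p))"
proof -
  have conv: "convex_on {0..} (\<lambda>x::real. x powr p)"
  proof (rule convex_onI)
    fix t x y :: real
    assume t: "0 < t" "t < 1" and "x \<in> {0..}" "y \<in> {0..}"
    then have xy: "x \<ge> 0" "y \<ge> 0" by auto
    have le: "r powr p \<le> r" if "0 < r" "r < 1" for r :: real
      using powr_mono'[of 1 p r] that assms(1) by simp
    consider "x > 0" "y > 0" | "x = 0" | "y = 0" using xy by linarith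
    then show "((1 - t) *\<^sub>R x + t *\<^sub>R y) powr p \<le> (1 - t) * x powr p + t * y powr p"
    proof cases
      case 1
      then show ?thesis
        using convex_onD[OF powr_convex[OF assms(1)], of t x y] t by simp
    next
      case 2
      then show ?thesis using t xy le[of t] assms by (simp add: powr_mult mult_right_mono)
    next
      case 3
      then show ?thesis using t xy le[of "1 - t"] assms by (simp add: powr_mult mult_right_mono)
    qed
  qed (simp add: convex_real_interval)
  have "((A / (A+B)) *\<^sub>R (u / A) + (B / (A+B)) *\<^sub>R (v / B)) powr p
      \<le> A / (A+B) * (u / A) powr p + B / (A+B) * (v / B) powr p"
  proof -
    have "1 - B / (A + B) = A / (A + B)" using assms by (simp add: field_simps)
    then show ?thesis
      using convex_onD[OF conv, of "B / (A+B)" "u / A" "v / B"] assms by (simp)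
  qed
  also have "(A / (A+B)) *\<^sub>R (u / A) + (B / (A+B)) *\<^sub>R (v / B) = (u + v) / (A + B)"
    using assms by (simp add: add_divide_distrib)
  finally show ?thesis
    using assms by (simp add: powr_divide pos_divide_le_eq mult.commute)
qed

lemma Lp_norm_triangle:
  assumes [measurable]: "\<xi> \<in> borel_measurable M" "\<eta> \<in> borel_measurable M" and p: "p \<ge> 1"
  shows "Lp_norm M p (\<lambda>\<omega>. \<xi> \<omega> + \<eta> \<omega>) \<le> Lp_norm M p \<xi> + Lp_norm M p \<eta>"
proof (cases "Lp_norm M p \<xi> + Lp_norm M p \<eta> = \<infinity>")
  case False
  then have "Lp_norm M p \<xi> \<noteq> \<infinity>" "Lp_norm M p \<eta> \<noteq> \<infinity>" by auto
  then obtain A B where AB: "Lp_norm M p \<xi> = ennreal A" "Lp_norm M p \<eta> = ennreal B" "A \<ge> 0" "B \<ge> 0"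
    by (metis ennreal_cases infinity_ennreal_def)
  show ?thesis
  proof (rule ennreal_le_epsilon)
    fix e :: real assume e: "e > 0"
    (* enlarging the two norms makes them positive, so that one may divide by them *)
    define A' B' where "A' = A + e / 2" and "B' = B + e / 2"
    have pos: "A' > 0" "B' > 0" using AB e by (auto simp: A'_def B'_def)
    define a b where "a = (A' + B') powr p * (A' / (A' + B')) / A' powr p"
      and "b = (A' + B') powr p * (B' / (A' + B')) / B' powr p"
    have ab: "a \<ge> 0" "b \<ge> 0" using pos by (auto simp: a_def b_def)
    have x: "(\<integral>\<^sup>+ \<omega>. ennreal (\<bar>\<xi> \<omega>\<bar> powr p) \<partial>M) \<le> ennreal (A' powr p)"
      using AB e p by (subst Lp_norm_le_iff[symmetric]) (auto simp: A'_def)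
    have y: "(\<integral>\<^sup>+ \<omega>. ennreal (\<bar>\<eta> \<omega>\<bar> powr p) \<partial>M) \<le> ennreal (B' powr p)"
      using AB e p by (subst Lp_norm_le_iff[symmetric]) (auto simp: B'_def)
    have "(\<integral>\<^sup>+ \<omega>. ennreal (\<bar>\<xi> \<omega> + \<eta> \<omega>\<bar> powr p) \<partial>M)
        \<le> (\<integral>\<^sup>+ \<omega>. ennreal a * ennreal (\<bar>\<xi> \<omega>\<bar> powr p) + ennreal b * ennreal (\<bar>\<eta> \<omega>\<bar> powr p) \<partial>M)"
    proof (rule nn_integral_mono)
      fix \<omega>
      have "\<bar>\<xi> \<omega> + \<eta> \<omega>\<bar> powr p \<le> (\<bar>\<xi> \<omega>\<bar> + \<bar>\<eta> \<omega>\<bar>) powr p"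
        using p by (intro powr_mono2) auto
      also have "\<dots> \<le> a * \<bar>\<xi> \<omega>\<bar> powr p + b * \<bar>\<eta> \<omega>\<bar> powr p"
        using powr_add_le_convex_combination[OF p pos, of "\<bar>\<xi> \<omega>\<bar>" "\<bar>\<eta> \<omega>\<bar>"]
        by (simp add: a_def b_def algebra_simps)
      finally show "ennreal (\<bar>\<xi> \<omega> + \<eta> \<omega>\<bar> powr p)
          \<le> ennreal a * ennreal (\<bar>\<xi> \<omega>\<bar> powr p) + ennreal b * ennreal (\<bar>\<eta> \<omega>\<bar> powr p)"
        using ab by (simp add: ennreal_mult[symmetric] ennreal_plus[symmetric] del: ennreal_plus)
    qed
    also have "\<dots> = ennreal a * (\<integral>\<^sup>+ \<omega>. ennreal (\<bar>\<xi> \<omega>\<bar> powr p) \<partial>M)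
                   + ennreal b * (\<integral>\<^sup>+ \<omega>. ennreal (\<bar>\<eta> \<omega>\<bar> powr p) \<partial>M)"
      by (simp add: nn_integral_add nn_integral_cmult)
    also have "\<dots> \<le> ennreal a * ennreal (A' powr p) + ennreal b * ennreal (B' powr p)"
      by (intro add_mono mult_left_mono x y) auto
    also have "\<dots> = ennreal (a * A' powr p + b * B' powr p)"
      using ab by (simp add: ennreal_mult[symmetric] ennreal_plus[symmetric] del: ennreal_plus)
    also have "a * A' powr p + b * B' powr p = (A' + B') powr p * ((A' + B') / (A' + B'))"
        by (simp only: a_def b_def add_divide_distrib distrib_left) (use pos in simp)
    also have "\<dots> = (A' + B') powr p" using pos by simp
    finally have "Lp_norm M p (\<lambda>\<omega>. \<xi> \<omega> + \<eta> \<omega>) \<le> ennreal (A' + B')"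
      using p pos by (subst Lp_norm_le_iff) auto
    also have "\<dots> = Lp_norm M p \<xi> + Lp_norm M p \<eta> + ennreal e"
      using AB e by (simp add: A'_def B'_def ennreal_plus[symmetric] del: ennreal_plus)
    finally show "Lp_norm M p (\<lambda>\<omega>. \<xi> \<omega> + \<eta> \<omega>) \<le> Lp_norm M p \<xi> + Lp_norm M p \<eta> + ennreal e" .
  qed
qed auto

lemma Lp_norm_zero: "p > 0 \<Longrightarrow> Lp_norm M p (\<lambda>\<omega>. 0) = 0"
  by (simp add: Lp_norm_def)

lemma Lp_norm_sum_le:
  assumes "finite I" "\<And>i. i \<in> I \<Longrightarrow> \<xi> i \<in> borel_measurable M" and "p \<ge> 1"
  shows "Lp_norm M p (\<lambda>\<omega>. \<Sum>i\<in>I. \<xi> i \<omega>) \<le> (\<Sum>i\<in>I. Lp_norm M p (\<xi> i))"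
  using assms
proof (induction I rule: finite_induct)
  case (insert i I)
  have "Lp_norm M p (\<lambda>\<omega>. \<xi> i \<omega> + (\<Sum>i\<in>I. \<xi> i \<omega>))
      \<le> Lp_norm M p (\<xi> i) + Lp_norm M p (\<lambda>\<omega>. \<Sum>i\<in>I. \<xi> i \<omega>)"
    using insert.prems by (intro Lp_norm_triangle borel_measurable_sum) auto
  also have "\<dots> \<le> Lp_norm M p (\<xi> i) + (\<Sum>i\<in>I. Lp_norm M p (\<xi> i))"
    using insert by (intro add_left_mono) auto
  finally show ?case using insert.hyps by simp
qed (simp add: Lp_norm_zero)

lemma Lp_norm_diff_commute:
  "Lp_norm M p (\<lambda>\<omega>. \<xi> \<omega> - \<eta> \<omega>) = Lp_norm M p (\<lambda>\<omega>. \<eta> \<omega> - \<xi> \<omega>)"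
  by (simp add: Lp_norm_def abs_minus_commute)

lemma Lp_norm_diff_triangle:
  assumes [measurable]: "\<xi> \<in> borel_measurable M" "\<eta> \<in> borel_measurable M" "\<zeta> \<in> borel_measurable M"
    and "p \<ge> 1"
  shows "Lp_norm M p (\<lambda>\<omega>. \<xi> \<omega> - \<zeta> \<omega>)
           \<le> Lp_norm M p (\<lambda>\<omega>. \<xi> \<omega> - \<eta> \<omega>) + Lp_norm M p (\<lambda>\<omega>. \<eta> \<omega> - \<zeta> \<omega>)"
  using Lp_norm_triangle[of "\<lambda>\<omega>. \<xi> \<omega> - \<eta> \<omega>" M "\<lambda>\<omega>. \<eta> \<omega> - \<zeta> \<omega>" p] assms by simp

text \<open>The squared factor leaves room for a Borel--Cantelli argument that works for all \<open>p > 0\<close> without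
  a comparison of \<open>L\<^sub>p\<close> with \<open>L\<^sub>1\<close>: the variables \<open>(2^k * \<bar>T (k + 1) - T k\<bar>) powr p\<close> have summable
  integrals, hence tend to \<open>0\<close> almost everywhere, so that the increments are eventually below \<open>2^-k\<close>.\<close>

lemma AE_Cauchy_of_fast_Lp_Cauchy:
  fixes T :: "nat \<Rightarrow> 'w \<Rightarrow> real"
  assumes [measurable]: "\<And>k. T k \<in> borel_measurable M" and p: "p > 0"
    and fast: "\<And>k. Lp_norm M p (\<lambda>\<omega>. T (Suc k) \<omega> - T k \<omega>) \<le> ennreal ((1/2) ^ k * (1/2) ^ k)"
  shows "AE \<omega> in M. Cauchy (\<lambda>k. T k \<omega>)"
proof -
  define q where "q = (1/2::real) powr p"
  have q: "0 < q" "q < 1" using p powr_less_mono2[of p "1/2" 1] by (auto simp: q_def)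
  define D where "D k \<omega> = \<bar>T (Suc k) \<omega> - T k \<omega>\<bar> powr p / q ^ k" for k \<omega>
  have [measurable]: "D k \<in> borel_measurable M" for k unfolding D_def by measurable
  have powq: "((1/2::real) ^ k) powr p = q ^ k" for k
    by (simp add: q_def powr_powr powr_realpow[symmetric] mult.commute)
  have "(\<integral>\<^sup>+ \<omega>. ennreal (D k \<omega>) \<partial>M) \<le> ennreal (q ^ k)" for k
  proof -
    have "(\<integral>\<^sup>+ \<omega>. ennreal (\<bar>T (Suc k) \<omega> - T k \<omega>\<bar> powr p) \<partial>M)
        \<le> ennreal (((1/2) ^ k * (1/2) ^ k) powr p)"
      using fast[of k] p by (subst (asm) Lp_norm_le_iff) auto
    also have "((1/2::real) ^ k * (1/2) ^ k) powr p = q ^ k * q ^ k"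
      by (simp add: powr_mult powq)
    finally have le: "(\<integral>\<^sup>+ \<omega>. ennreal (\<bar>T (Suc k) \<omega> - T k \<omega>\<bar> powr p) \<partial>M) \<le> ennreal (q ^ k * q ^ k)" .
    have "(\<integral>\<^sup>+ \<omega>. ennreal (D k \<omega>) \<partial>M)
        = (\<integral>\<^sup>+ \<omega>. ennreal (1 / q ^ k) * ennreal (\<bar>T (Suc k) \<omega> - T k \<omega>\<bar> powr p) \<partial>M)"
      using q by (intro nn_integral_cong) (simp add: D_def ennreal_mult[symmetric])
    also have "\<dots> = ennreal (1 / q ^ k) * (\<integral>\<^sup>+ \<omega>. ennreal (\<bar>T (Suc k) \<omega> - T k \<omega>\<bar> powr p) \<partial>M)"
      by (simp add: nn_integral_cmult)
    also have "\<dots> \<le> ennreal (1 / q ^ k) * ennreal (q ^ k * q ^ k)"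
      by (intro mult_left_mono le) auto
    also have "\<dots> = ennreal (q ^ k)" using q by (simp add: ennreal_mult[symmetric])
    finally show ?thesis .
  qed
  then have "(\<Sum>k. \<integral>\<^sup>+ \<omega>. ennreal (D k \<omega>) \<partial>M) \<le> (\<Sum>k. ennreal (q ^ k))"
    by (intro suminf_le) auto
  also have "\<dots> < \<infinity>"
    using q by (simp add: ennreal_suminf_neq_top less_top[symmetric] summable_geometric)
  finally have "(\<integral>\<^sup>+ \<omega>. (\<Sum>k. ennreal (D k \<omega>)) \<partial>M) \<noteq> \<infinity>"
    by (subst nn_integral_suminf) auto
  then have "AE \<omega> in M. (\<Sum>k. ennreal (D k \<omega>)) \<noteq> \<infinity>"
    by (intro nn_integral_PInf_AE) auto
  then show ?thesis
  proof eventually_elim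
    case (elim \<omega>)
    have nn: "D k \<omega> \<ge> 0" for k using q by (simp add: D_def)
    have "summable (\<lambda>k. D k \<omega>)"
      using elim nn by (intro summable_suminf_not_top) auto
    then have "(\<lambda>k. D k \<omega>) \<longlonglongrightarrow> 0" by (rule summable_LIMSEQ_zero)
    then have "eventually (\<lambda>k. D k \<omega> < 1) sequentially"
      by (rule order_tendstoD) simp
    then have "eventually (\<lambda>k. norm (T (Suc k) \<omega> - T k \<omega>) \<le> (1/2) ^ k) sequentially"
    proof eventually_elim
      case (elim k)
      then have "\<bar>T (Suc k) \<omega> - T k \<omega>\<bar> powr p < ((1/2) ^ k) powr p"
        using q by (simp add: D_def powq divide_less_eq)
      then show ?case
        using p by (metis abs_ge_zero linorder_not_le order_less_imp_le powr_mono2 real_norm_def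
            zero_le_divide_1_iff zero_le_numeral zero_le_power)
    qed
    then have "summable (\<lambda>k. T (Suc k) \<omega> - T k \<omega>)"
      by (rule summable_comparison_test_ev) (simp add: summable_geometric)
    then have "convergent (\<lambda>n. \<Sum>k<n. T (Suc k) \<omega> - T k \<omega>)"
      by (simp add: summable_iff_convergent)
    then have "convergent (\<lambda>n. T n \<omega> - T 0 \<omega>)" by (simp add: sum_lessThan_telescope[of "\<lambda>k. T k \<omega>"])
    then have "convergent (\<lambda>n. (T n \<omega> - T 0 \<omega>) + T 0 \<omega>)" by (intro convergent_add convergent_const)
    then show ?case by (simp add: convergent_Cauchy)
  qed
qed

text \<open>Fatou's lemma in terms of norms.\<close>

lemma Lp_norm_le_of_AE_limit:
  fixes T :: "nat \<Rightarrow> 'w \<Rightarrow> real"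
  assumes [measurable]: "\<And>k. T k \<in> borel_measurable M" "\<xi> \<in> borel_measurable M" and p: "p > 0"
    and lim: "AE \<omega> in M. (\<lambda>k. T k \<omega>) \<longlonglongrightarrow> \<xi> \<omega>"
    and bd: "eventually (\<lambda>k. Lp_norm M p (T k) \<le> ennreal c) sequentially" and c: "c \<ge> 0"
  shows "Lp_norm M p \<xi> \<le> ennreal c"
proof -
  have "(\<integral>\<^sup>+ \<omega>. ennreal (\<bar>\<xi> \<omega>\<bar> powr p) \<partial>M) = (\<integral>\<^sup>+ \<omega>. liminf (\<lambda>k. ennreal (\<bar>T k \<omega>\<bar> powr p)) \<partial>M)"
  proof (rule nn_integral_cong_AE, use lim in eventually_elim)
    case (elim \<omega>)
    then have "(\<lambda>k. ennreal (\<bar>T k \<omega>\<bar> powr p)) \<longlonglongrightarrow> ennreal (\<bar>\<xi> \<omega>\<bar> powr p)"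
      using p by (intro tendsto_ennrealI tendsto_powr' tendsto_rabs) auto
    then show ?case by (intro lim_imp_Liminf[symmetric]) auto
  qed
  also have "\<dots> \<le> liminf (\<lambda>k. \<integral>\<^sup>+ \<omega>. ennreal (\<bar>T k \<omega>\<bar> powr p) \<partial>M)"
    by (rule nn_integral_liminf) measurable
  also have "\<dots> \<le> limsup (\<lambda>k. \<integral>\<^sup>+ \<omega>. ennreal (\<bar>T k \<omega>\<bar> powr p) \<partial>M)"
    by (rule Liminf_le_Limsup) simp
  also have "\<dots> \<le> ennreal (c powr p)"
    using bd p c by (intro Limsup_bounded) (simp add: Lp_norm_le_iff)
  finally show ?thesis using p c by (simp add: Lp_norm_le_iff)
qed

text \<open>A fast subsequence converges almost everywhere, and Fatou's lemma passes the Cauchy estimate to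
  its limit.  The \<open>S k\<close> themselves need not have finite norm; only their differences matter.\<close>

lemma Lp_complete:
  fixes S :: "nat \<Rightarrow> 'w \<Rightarrow> real"
  assumes meas[measurable]: "\<And>k. S k \<in> borel_measurable M" and p: "p > 0"
    and cauchy: "\<And>e. e > 0 \<Longrightarrow> \<exists>N. \<forall>m\<ge>N. \<forall>n\<ge>N. Lp_norm M p (\<lambda>\<omega>. S m \<omega> - S n \<omega>) \<le> ennreal e"
  shows "\<exists>Z\<in>borel_measurable M. (\<lambda>k. Lp_norm M p (\<lambda>\<omega>. Z \<omega> - S k \<omega>)) \<longlonglongrightarrow> 0"
proof -
  have "\<forall>k. \<exists>N. \<forall>m\<ge>N. \<forall>n\<ge>N. Lp_norm M p (\<lambda>\<omega>. S m \<omega> - S n \<omega>) \<le> ennreal ((1/2) ^ k * (1/2) ^ k)"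
    by (intro allI cauchy) simp
  then obtain N where N: "\<And>k m n. m \<ge> N k \<Longrightarrow> n \<ge> N k \<Longrightarrow>
      Lp_norm M p (\<lambda>\<omega>. S m \<omega> - S n \<omega>) \<le> ennreal ((1/2) ^ k * (1/2) ^ k)"
    by metis
  (* the sum makes r k at least as large as all of N 0, ..., N k, so that r k and r (k + 1) are both beyond N k *)
  define r where "r k = k + (\<Sum>i\<le>k. N i)" for k
  have "N k \<le> (\<Sum>i\<le>k. N i)" for k by (rule member_le_sum) auto
  then have rN: "r k \<ge> N k" and rN': "r (Suc k) \<ge> N k" for k
    by (simp_all add: r_def trans_le_add1 trans_le_add2 le_SucI)
  have rk: "r k \<ge> k" for k by (simp add: r_def)
  have "AE \<omega> in M. Cauchy (\<lambda>k. S (r k) \<omega>)"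
    by (intro AE_Cauchy_of_fast_Lp_Cauchy[OF _ p] N rN rN') simp
  moreover define Z where "Z \<omega> = lim (\<lambda>k. S (r k) \<omega>)" for \<omega>
  ultimately have lim: "AE \<omega> in M. (\<lambda>k. S (r k) \<omega>) \<longlonglongrightarrow> Z \<omega>"
    by (auto simp: Cauchy_convergent_iff convergent_LIMSEQ_iff)
  have Z[measurable]: "Z \<in> borel_measurable M" unfolding Z_def by measurable
  have "(\<lambda>k. Lp_norm M p (\<lambda>\<omega>. Z \<omega> - S k \<omega>)) \<longlonglongrightarrow> 0"
  proof (rule tendsto_zero_ennreal)
    fix e :: real assume e: "e > 0"
    obtain K where K: "\<And>m n. m \<ge> K \<Longrightarrow> n \<ge> K \<Longrightarrow> Lp_norm M p (\<lambda>\<omega>. S m \<omega> - S n \<omega>) \<le> ennreal (e / 2)"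
      using cauchy[of "e / 2"] e by auto
    show "eventually (\<lambda>k. Lp_norm M p (\<lambda>\<omega>. Z \<omega> - S k \<omega>) < ennreal e) sequentially"
      using eventually_ge_at_top[of K]
    proof eventually_elim
      case (elim n)
      have "Lp_norm M p (\<lambda>\<omega>. Z \<omega> - S n \<omega>) \<le> ennreal (e / 2)"
      proof (rule Lp_norm_le_of_AE_limit[where T = "\<lambda>k \<omega>. S (r k) \<omega> - S n \<omega>"])
        show "AE \<omega> in M. (\<lambda>k. S (r k) \<omega> - S n \<omega>) \<longlonglongrightarrow> Z \<omega> - S n \<omega>"
          using lim by eventually_elim (intro tendsto_intros)
        show "eventually (\<lambda>k. Lp_norm M p (\<lambda>\<omega>. S (r k) \<omega> - S n \<omega>) \<le> ennreal (e / 2)) sequentially"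
          using eventually_ge_at_top[of K] by eventually_elim (use elim rk in \<open>auto intro!: K le_trans[OF _ rk]\<close>)
      qed (use p e in auto)
      also have "\<dots> < ennreal e" using e by (simp add: ennreal_lessI)
      finally show ?case .
    qed
  qed
  with Z show ?thesis by blast
qed

section \<open>Thinning out a partition\<close>

definition next_point :: "real set \<Rightarrow> real \<Rightarrow> real" where
  "next_point P u = Min {v \<in> P. u < v}"

definition prev_point :: "real set \<Rightarrow> real \<Rightarrow> real" where
  "prev_point P u = Max {v \<in> P. v < u}"

text \<open>The end point \<open>b\<close> is a parameter because it stays fixed while points are deleted; it is the one
  point without a successor.\<close>

definition set_forward_sum :: "(real \<Rightarrow> real) \<Rightarrow> (real \<Rightarrow> real) \<Rightarrow> real \<Rightarrow> real set \<Rightarrow> real" where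
  "set_forward_sum y x b P = (\<Sum>u\<in>P - {b}. y u * (x (next_point P u) - x u))"

lemma next_point_eqI:
  assumes "finite P" "w \<in> P" "v < w" "\<And>z. z \<in> P \<Longrightarrow> v < z \<Longrightarrow> w \<le> z"
  shows "next_point P v = w"
  unfolding next_point_def using assms by (intro Min_eqI) auto

lemma next_point:
  assumes "finite P" "v \<in> P" "u < v"
  shows "next_point P u \<in> P" "u < next_point P u" "next_point P u \<le> v"
proof -
  have "next_point P u \<in> {v \<in> P. u < v}"
    unfolding next_point_def using assms by (intro Min_in) auto
  then show "next_point P u \<in> P" "u < next_point P u" by auto
  show "next_point P u \<le> v"
    unfolding next_point_def using assms by (intro Min_le) auto
qed

lemma prev_point:
  assumes "finite P" "v \<in> P" "v < u"
  shows "prev_point P u \<in> P" "prev_point P u < u" "v \<le> prev_point P u"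
proof -
  have "prev_point P u \<in> {v \<in> P. v < u}"
    unfolding prev_point_def using assms by (intro Max_in) auto
  then show "prev_point P u \<in> P" "prev_point P u < u" by auto
  show "v \<le> prev_point P u"
    unfolding prev_point_def using assms by (intro Max_ge) auto
qed

text \<open>Only the terms of \<open>u\<close> and of its predecessor change.\<close>

lemma set_forward_sum_remove:
  assumes fin: "finite P" and P: "P \<subseteq> {a..b}" "a \<in> P" "b \<in> P" "u \<in> P" "a < u" "u < b"
  shows "set_forward_sum y x b P - set_forward_sum y x b (P - {u})
         = (y u - y (prev_point P u)) * (x (next_point P u) - x u)"
proof -
  define l r where "l = prev_point P u" and "r = next_point P u"
  note l = prev_point[OF fin \<open>a \<in> P\<close> \<open>a < u\<close>, folded l_def]
  note r = next_point[OF fin \<open>b \<in> P\<close> \<open>u < b\<close>, folded r_def]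
  have l': "z \<le> l" if "z \<in> P" "z < u" for z using prev_point(3)[OF fin that] by (simp add: l_def)
  have r': "r \<le> z" if "z \<in> P" "u < z" for z using next_point(3)[OF fin that] by (simp add: r_def)
  have nl: "next_point P l = u"
    using fin P l l' by (intro next_point_eqI) force+
  have nl': "next_point (P - {u}) l = r"
  proof (rule next_point_eqI)
    fix z assume "z \<in> P - {u}" "l < z"
    then show "r \<le> z" using l'[of z] r'[of z] by force
  qed (use fin l r in auto)
  have nv: "next_point (P - {u}) v = next_point P v" if v: "v \<in> P - {b} - {l} - {u}" for v
  proof (rule next_point_eqI)
    have "v < b" using v P by force
    note n = next_point[OF fin \<open>b \<in> P\<close> \<open>v < b\<close>]
    have "next_point P v \<noteq> u"
    proof
      assume eq: "next_point P v = u"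
      then have "v < l" using n l'[of v] v by force
      then show False using next_point(3)[OF fin l(1)] eq l(2) by force
    qed
    then show "next_point P v \<in> P - {u}" "v < next_point P v" using n by auto
    show "next_point P v \<le> z" if "z \<in> P - {u}" "v < z" for z
      using next_point(3)[OF fin] that by auto
  qed (use fin in simp)
  define R where "R = (\<Sum>v\<in>P - {b} - {l} - {u}. y v * (x (next_point P v) - x v))"
  have "set_forward_sum y x b P = y l * (x u - x l) + (y u * (x r - x u) + R)"
  proof -
    have "set_forward_sum y x b P
        = y l * (x (next_point P l) - x l) + (\<Sum>v\<in>P - {b} - {l}. y v * (x (next_point P v) - x v))"
      unfolding set_forward_sum_def using fin P l by (intro sum.remove) auto
    also have "(\<Sum>v\<in>P - {b} - {l}. y v * (x (next_point P v) - x v))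
        = y u * (x (next_point P u) - x u) + R"
      unfolding R_def using fin P l by (intro sum.remove) auto
    finally show ?thesis by (simp add: nl r_def)
  qed
  moreover have "set_forward_sum y x b (P - {u}) = y l * (x r - x l) + R"
  proof -
    have "set_forward_sum y x b (P - {u}) = y l * (x (next_point (P - {u}) l) - x l)
        + (\<Sum>v\<in>P - {u} - {b} - {l}. y v * (x (next_point (P - {u}) v) - x v))"
      unfolding set_forward_sum_def using fin P l by (intro sum.remove) auto
    also have "(\<Sum>v\<in>P - {u} - {b} - {l}. y v * (x (next_point (P - {u}) v) - x v)) = R"
      unfolding R_def using nv by (intro sum.cong) auto
    finally show ?thesis by (simp add: nl')
  qed
  ultimately show ?thesis by (simp add: l_def[symmetric] r_def[symmetric] algebra_simps)
qed

text \<open>Of three points in an interval of length \<open>w\<close>, the middle one would have both neighbours in that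
  interval.\<close>

lemma card_le_2_of_wide_gaps:
  fixes l r :: "real \<Rightarrow> real"
  assumes "finite B" "B \<subseteq> {c..c + w}"
    and "\<And>u v. u \<in> B \<Longrightarrow> v \<in> B \<Longrightarrow> v < u \<Longrightarrow> v \<le> l u"
    and "\<And>u v. u \<in> B \<Longrightarrow> v \<in> B \<Longrightarrow> u < v \<Longrightarrow> r u \<le> v"
    and "\<And>u. u \<in> B \<Longrightarrow> w < r u - l u"
  shows "card B \<le> 2"
proof (rule ccontr)
  assume "\<not> card B \<le> 2"
  then have big: "card B > 2" and "B \<noteq> {}" by auto
  define m M where "m = Min B" and "M = Max B"
  have mM: "m \<in> B" "M \<in> B" using assms(1) \<open>B \<noteq> {}\<close> by (auto simp: m_def M_def)
  have "card {m, M} \<le> 2" by (simp add: card_insert_if)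
  then have "\<not> B \<subseteq> {m, M}" using big card_mono[of "{m, M}" B] by auto
  then obtain u where u: "u \<in> B" "u \<noteq> m" "u \<noteq> M" by auto
  then have "m < u" "u < M" using assms(1) by (auto simp: m_def M_def less_le)
  then have "m \<le> l u" "r u \<le> M" using assms(3,4) u mM by auto
  then have "w < M - m" using assms(5)[OF u(1)] by auto
  moreover have "c \<le> m" "M \<le> c + w" using mM assms(2) by auto
  ultimately show False by linarith
qed

text \<open>Each closed third of \<open>(s, t)\<close> contains at most two of the points.\<close>

lemma card_le_6_of_wide_gaps:
  fixes l r :: "real \<Rightarrow> real"
  assumes fin: "finite A" and A: "A \<subseteq> {s<..<t}"
    and l: "\<And>u v. u \<in> A \<Longrightarrow> v \<in> A \<Longrightarrow> v < u \<Longrightarrow> v \<le> l u"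
    and r: "\<And>u v. u \<in> A \<Longrightarrow> v \<in> A \<Longrightarrow> u < v \<Longrightarrow> r u \<le> v"
    and wide: "\<And>u. u \<in> A \<Longrightarrow> (t - s) / 3 < r u - l u"
  shows "card A \<le> 6"
proof -
  define w where "w = (t - s) / 3"
  define B where "B c = A \<inter> {c..c + w}" for c
  have B: "card (B c) \<le> 2" for c
    using fin l r wide by (intro card_le_2_of_wide_gaps[of _ c w l r]) (auto simp: B_def w_def)
  have "A \<subseteq> (B s \<union> B (s + w)) \<union> B (s + 2 * w)"
  proof
    fix v assume "v \<in> A"
    then have "s < v" "v < t" using A by auto
    moreover have "t = s + 3 * w" by (simp add: w_def field_simps)
    ultimately show "v \<in> (B s \<union> B (s + w)) \<union> B (s + 2 * w)"
      using \<open>v \<in> A\<close> unfolding B_def by simp linarith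
  qed
  then have "card A \<le> card ((B s \<union> B (s + w)) \<union> B (s + 2 * w))"
    using fin by (intro card_mono) (auto simp: B_def)
  also have "\<dots> \<le> card (B s \<union> B (s + w)) + card (B (s + 2 * w))" by (rule card_Un_le)
  also have "card (B s \<union> B (s + w)) \<le> card (B s) + card (B (s + w))" by (rule card_Un_le)
  finally show ?thesis using B[of s] B[of "s + w"] B[of "s + 2 * w"] by linarith
qed

text \<open>Every deletable point is recorded with its two neighbours at the moment of its deletion.  The last
  clause bounds the overlap of the squares that will be attached to the deletions; it is what the
  choice of the smallest gap buys.  For given \<open>s\<close> and \<open>t\<close>, deletions with small gap do not count, and as
  soon as the smallest gap exceeds \<open>(t - s) / 3\<close> at most six deletable points are left in \<open>(s, t)\<close>.\<close>

lemma greedy_thinning: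
  assumes "finite P" "Q \<subseteq> P" "a \<in> Q" "b \<in> Q" "P \<subseteq> {a..b}"
  shows "\<exists>l r.
    (\<forall>y x. set_forward_sum y x b P - set_forward_sum y x b Q
             = (\<Sum>u\<in>P - Q. (y u - y (l u)) * (x (r u) - x u))) \<and>
    (\<forall>u\<in>P - Q. l u < u \<and> u < r u \<and> (\<forall>q\<in>Q. q < u \<longrightarrow> q \<le> l u) \<and> (\<forall>q\<in>Q. u < q \<longrightarrow> r u \<le> q)) \<and>
    (\<forall>s t. card {u \<in> P - Q. s < l u \<and> r u < t \<and> t - s < 3 * (r u - l u)} \<le> 6)"
  using assms
proof (induction "card (P - Q)" arbitrary: P)
  case 0
  then have "P - Q = {}" by simp
  then have "P = Q" using 0 by auto
  then show ?case by simp
next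
  case (Suc n)
  define gap where "gap u = next_point P u - prev_point P u" for u
  have "P - Q \<noteq> {}" "finite (P - Q)" using Suc.hyps Suc.prems by auto
  then obtain u where u: "u \<in> P - Q" and umin: "\<And>v. v \<in> P - Q \<Longrightarrow> gap u \<le> gap v"
    using ex_is_arg_min_if_finite[of "P - Q" gap] by (auto simp: is_arg_min_linorder)
  have ends: "a < v" "v < b" if "v \<in> P - Q" for v
    using that Suc.prems(3-5) by (force simp: less_le)+
  have ab: "a \<in> P" "b \<in> P" using Suc.prems by auto
  note prev = prev_point[OF \<open>finite P\<close>] and succ = next_point[OF \<open>finite P\<close>]
  have eq: "P - Q = insert u ((P - {u}) - Q)" "u \<notin> (P - {u}) - Q" using u by auto
  have "n = card ((P - {u}) - Q)" using Suc.hyps Suc.prems eq by simp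
  moreover have "finite (P - {u})" "Q \<subseteq> P - {u}" "P - {u} \<subseteq> {a..b}" using Suc.prems u by auto
  ultimately obtain l0 r0 where
    tel: "\<And>y x. set_forward_sum y x b (P - {u}) - set_forward_sum y x b Q
             = (\<Sum>u\<in>(P - {u}) - Q. (y u - y (l0 u)) * (x (r0 u) - x u))"
    and bet: "\<And>v. v \<in> (P - {u}) - Q \<Longrightarrow> l0 v < v \<and> v < r0 v \<and> (\<forall>q\<in>Q. q < v \<longrightarrow> q \<le> l0 v) \<and> (\<forall>q\<in>Q. v < q \<longrightarrow> r0 v \<le> q)"
    and cnt: "\<And>s t. card {v \<in> (P - {u}) - Q. s < l0 v \<and> r0 v < t \<and> t - s < 3 * (r0 v - l0 v)} \<le> 6"
    using Suc.hyps(1)[of "P - {u}"] Suc.prems(3,4) by blast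
  define l r where "l = l0(u := prev_point P u)" and "r = r0(u := next_point P u)"
  have lru: "l u = prev_point P u" "r u = next_point P u" by (simp_all add: l_def r_def)
  have lrv: "l v = l0 v" "r v = r0 v" if "v \<in> (P - {u}) - Q" for v
    using that by (auto simp: l_def r_def)
  have b: "l v < v \<and> v < r v \<and> (\<forall>q\<in>Q. q < v \<longrightarrow> q \<le> l v) \<and> (\<forall>q\<in>Q. v < q \<longrightarrow> r v \<le> q)"
    if v: "v \<in> P - Q" for v
  proof (cases "v = u")
    case True
    have "q \<le> prev_point P u" if "q \<in> Q" "q < u" for q using that prev(3) Suc.prems by auto
    moreover have "next_point P u \<le> q" if "q \<in> Q" "u < q" for q using that succ(3) Suc.prems by auto
    ultimately show ?thesis
      using True prev(2)[OF ab(1) ends(1)[OF u]] succ(2)[OF ab(2) ends(2)[OF u]] by (auto simp: lru)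
  next
    case False
    then show ?thesis using bet[of v] v lrv[of v] by simp
  qed
  have "set_forward_sum y x b P - set_forward_sum y x b Q
             = (\<Sum>u\<in>P - Q. (y u - y (l u)) * (x (r u) - x u))" for y x
  proof -
    have "set_forward_sum y x b P - set_forward_sum y x b (P - {u}) = (y u - y (l u)) * (x (r u) - x u)"
      unfolding lru using ab ends[OF u] u Suc.prems by (intro set_forward_sum_remove) auto
    moreover have "(\<Sum>u\<in>(P - {u}) - Q. (y u - y (l0 u)) * (x (r0 u) - x u))
        = (\<Sum>u\<in>(P - {u}) - Q. (y u - y (l u)) * (x (r u) - x u))"
      by (intro sum.cong) (auto simp: lrv)
    ultimately show ?thesis
      using tel[of y x] eq(2) Suc.prems by (subst eq(1)) simp
  qed
  moreover have "card {v \<in> P - Q. s < l v \<and> r v < t \<and> t - s < 3 * (r v - l v)} \<le> 6" for s t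
  proof (cases "t - s < 3 * gap u")
    case True
    (* even the smallest gap is wider than (t - s) / 3, hence all gaps are *)
    have "card ((P - Q) \<inter> {s<..<t}) \<le> 6"
    proof (rule card_le_6_of_wide_gaps[where l = "prev_point P" and r = "next_point P" and s = s and t = t])
      fix v assume "v \<in> (P - Q) \<inter> {s<..<t}"
      then show "(t - s) / 3 < next_point P v - prev_point P v"
        using umin[of v] True by (simp add: gap_def)
    qed (use prev(3) succ(3) Suc.prems in auto)
    moreover have "{v \<in> P - Q. s < l v \<and> r v < t \<and> t - s < 3 * (r v - l v)} \<subseteq> (P - Q) \<inter> {s<..<t}"
      using b by force
    ultimately show ?thesis
      using Suc.prems(1) by (meson card_mono finite_Diff finite_Int le_trans)
  next
    case False
    have "v \<in> P - Q \<and> s < l v \<and> r v < t \<and> t - s < 3 * (r v - l v) \<longleftrightarrow>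
          v \<in> (P - {u}) - Q \<and> s < l0 v \<and> r0 v < t \<and> t - s < 3 * (r0 v - l0 v)" for v
    proof (cases "v = u")
      case True
      then show ?thesis using False by (simp add: gap_def lru)
    qed (use lrv[of v] in auto)
    then have "{v \<in> P - Q. s < l v \<and> r v < t \<and> t - s < 3 * (r v - l v)}
        = {v \<in> (P - {u}) - Q. s < l0 v \<and> r0 v < t \<and> t - s < 3 * (r0 v - l0 v)}"
      by (intro Collect_cong)
    then show ?thesis using cnt by simp
  qed
  ultimately show ?case using b by blast
qed

section \<open>The costs of deletion as an integral over the plane\<close>

text \<open>The rationals make the supremum below countable; the end points are added because the extension
  has to reach \<open>f a r\<close> for \<open>s < a\<close> and \<open>f l b\<close> for \<open>t > b\<close>.\<close>

definition grid_pairs :: "real \<Rightarrow> real \<Rightarrow> (real \<times> real) set" where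
  "grid_pairs a b = {(q, r). q \<in> insert a (insert b (\<rat> \<inter> {a..b})) \<and>
                            r \<in> insert a (insert b (\<rat> \<inter> {a..b})) \<and> q \<le> r}"

text \<open>A Borel measurable replacement of \<open>f (max s a) (min t b)\<close> on the whole plane: by monotonicity it
  is the supremum of \<open>f l r\<close> over \<open>s < l \<le> r < t\<close> with \<open>a \<le> l\<close> and \<open>r \<le> b\<close>, and it equals \<open>0\<close> when
  there are no such \<open>l\<close> and \<open>r\<close>.\<close>

definition extension :: "(real \<Rightarrow> real \<Rightarrow> real) \<Rightarrow> real \<Rightarrow> real \<Rightarrow> real \<times> real \<Rightarrow> ennreal" where
  "extension f a b z = (SUP (q, r)\<in>grid_pairs a b. ennreal (f q r) * indicator ({..<q} \<times> {r<..}) z)"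

text \<open>The bounds \<open>2 * a - b\<close> and \<open>2 * b - a\<close> allow for an overhang by \<open>b - a\<close> on either side, the largest
  possible side of a square.  They bound the region independently of \<open>d\<close>, so that the band for
  \<open>d = b - a\<close> contains all others and the integral over the corner \<open>s < a\<close>, \<open>t > b\<close> stays below the term
  \<open>f a b\<close> of \<open>I_fun\<close>.\<close>

definition band :: "real \<Rightarrow> real \<Rightarrow> real \<Rightarrow> (real \<times> real) set" where
  "band a b d = {(s, t). 2 * a - b < s \<and> t < 2 * b - a \<and> s < t \<and> t < s + 3 * d}"

definition band_density :: "(real \<Rightarrow> real \<Rightarrow> real) \<Rightarrow> real \<Rightarrow> real \<Rightarrow> real \<Rightarrow> real \<times> real \<Rightarrow> ennreal" where
  "band_density f a b d z = extension f a b z * ennreal (1 / (snd z - fst z)\<^sup>2) * indicator (band a b d) z"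

definition plane_integral :: "(real \<Rightarrow> real \<Rightarrow> real) \<Rightarrow> real \<Rightarrow> real \<Rightarrow> real \<Rightarrow> ennreal" where
  "plane_integral f a b d = (\<integral>\<^sup>+ z. band_density f a b d z \<partial>(lborel \<Otimes>\<^sub>M lborel))"

lemma countable_grid_pairs: "countable (grid_pairs a b)"
proof -
  let ?D = "insert a (insert b (\<rat> \<inter> {a..b}))"
  have D: "countable ?D" by (rule countable_insert, rule countable_insert, rule countable_Int1, rule countable_rat)
  have "grid_pairs a b \<subseteq> ?D \<times> ?D"
    unfolding grid_pairs_def by blast
  then show ?thesis
    by (rule countable_subset) (rule countable_SIGMA[OF D D])
qed

lemma measurable_extension[measurable]:
  "extension f a b \<in> borel_measurable (lborel \<Otimes>\<^sub>M lborel)"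
proof -
  have "(\<lambda>z. case x of (q, r) \<Rightarrow> ennreal (f q r) * indicator ({..<q} \<times> {r<..}) z)
      \<in> borel_measurable (lborel \<Otimes>\<^sub>M lborel)" for x
  proof (cases x)
    case (Pair q r)
    have [measurable]: "{..<q} \<times> {r<..} \<in> sets (lborel \<Otimes>\<^sub>M lborel :: (real \<times> real) measure)"
      by (intro pair_measureI) auto
    show ?thesis unfolding Pair prod.case by measurable
  qed
  then show ?thesis
    unfolding extension_def[abs_def] by (rule borel_measurable_SUP[OF countable_grid_pairs])
qed

lemma measurable_band_density[measurable]: "band_density f a b d \<in> borel_measurable (lborel \<Otimes>\<^sub>M lborel)"
proof -
  have "Measurable.pred (lborel \<Otimes>\<^sub>M lborel) (\<lambda>z. z \<in> band a b d)"
    unfolding band_def mem_Collect_eq case_prod_beta by measurable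
  then show ?thesis unfolding band_density_def[abs_def] by measurable
qed

locale monotone_interval_function =
  fixes f :: "real \<Rightarrow> real \<Rightarrow> real" and a b :: real
  assumes ab: "a < b"
    and mono1: "\<And>s s' t. a \<le> s \<Longrightarrow> s \<le> s' \<Longrightarrow> s' \<le> t \<Longrightarrow> t \<le> b \<Longrightarrow> f s' t \<le> f s t"
    and mono2: "\<And>s t t'. a \<le> s \<Longrightarrow> s \<le> t \<Longrightarrow> t \<le> t' \<Longrightarrow> t' \<le> b \<Longrightarrow> f s t \<le> f s t'"
    and diag: "\<And>t. t \<in> {a..b} \<Longrightarrow> f t t = 0"
begin

lemma nonneg: "a \<le> s \<Longrightarrow> s \<le> t \<Longrightarrow> t \<le> b \<Longrightarrow> 0 \<le> f s t"
  using mono2[of s s t] diag[of s] by auto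

lemma mono: "a \<le> s \<Longrightarrow> s \<le> s' \<Longrightarrow> s' \<le> t' \<Longrightarrow> t' \<le> t \<Longrightarrow> t \<le> b \<Longrightarrow> f s' t' \<le> f s t"
  using mono1[of s s' t'] mono2[of s t' t] by linarith

lemma grid_pairsD: "(q, r) \<in> grid_pairs a b \<Longrightarrow> a \<le> q \<and> q \<le> r \<and> r \<le> b"
  using ab by (auto simp: grid_pairs_def)

lemma extension_le: "extension f a b (s, t) \<le> ennreal (f (max s a) (min t b))"
  unfolding extension_def
proof (rule SUP_least, clarify)
  fix q r assume qr: "(q, r) \<in> grid_pairs a b"
  show "ennreal (f q r) * indicator ({..<q} \<times> {r<..}) (s, t) \<le> ennreal (f (max s a) (min t b))"
    using mono[of "max s a" q r "min t b"] grid_pairsD[OF qr]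
    by (auto split: split_indicator intro!: ennreal_leI)
qed

lemma extension_eq_0: "t \<le> a \<or> b \<le> s \<Longrightarrow> extension f a b (s, t) = 0"
proof -
  assume outside: "t \<le> a \<or> b \<le> s"
  have "extension f a b (s, t) \<le> 0"
    unfolding extension_def
  proof (rule SUP_least, clarify)
    fix q r assume "(q, r) \<in> grid_pairs a b"
    then show "ennreal (f q r) * indicator ({..<q} \<times> {r<..}) (s, t) \<le> 0"
      using outside by (auto split: split_indicator dest!: grid_pairsD)
  qed
  then show ?thesis by simp
qed

lemma le_extension:
  assumes "s < l" "l \<le> r" "r < t" "a \<le> l" "r \<le> b"
  shows "ennreal (f l r) \<le> extension f a b (s, t)"
proof -
  have "\<exists>q. q \<in> insert a (insert b (\<rat> \<inter> {a..b})) \<and> s < q \<and> q \<le> l"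
  proof (cases "l = a")
    case False
    then have "max s a < l" using assms by auto
    from Rats_dense_in_real[OF this] obtain q where "q \<in> \<rat>" "max s a < q" "q < l" by auto
    then show ?thesis using assms by (intro exI[of _ q]) auto
  qed (use assms in auto)
  then obtain q where q: "q \<in> insert a (insert b (\<rat> \<inter> {a..b}))" "s < q" "q \<le> l" by blast
  have "\<exists>q. q \<in> insert a (insert b (\<rat> \<inter> {a..b})) \<and> q < t \<and> r \<le> q"
  proof (cases "r = b")
    case False
    then have "r < min t b" using assms by auto
    from Rats_dense_in_real[OF this] obtain q where "q \<in> \<rat>" "q < min t b" "r < q" by auto
    then show ?thesis using assms by (intro exI[of _ q]) auto
  qed (use assms in auto)
  then obtain q' where q': "q' \<in> insert a (insert b (\<rat> \<inter> {a..b}))" "q' < t" "r \<le> q'" by blast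
  have in_grid: "(q, q') \<in> grid_pairs a b" using q q' assms by (auto simp: grid_pairs_def)
  have "ennreal (f l r) \<le> ennreal (f q q')"
    using grid_pairsD[OF in_grid] q q' assms by (intro ennreal_leI mono) auto
  also have "\<dots> = (case (q, q') of (q, r) \<Rightarrow> ennreal (f q r) * indicator ({..<q} \<times> {r<..}) (s, t))"
    using q q' by simp
  also have "\<dots> \<le> extension f a b (s, t)"
    unfolding extension_def by (rule SUP_upper[OF in_grid])
  finally show ?thesis .
qed

text \<open>The square has area \<open>(r - l)^2\<close>, and on it \<open>t - s\<close> is at most \<open>3 * (r - l)\<close>.\<close>

lemma le_integral_over_square:
  assumes "l < r" "a \<le> l" "r \<le> b"
  shows "ennreal (f l r) \<le> 9 * (\<integral>\<^sup>+ z. ennreal (f l r) * ennreal (1 / (snd z - fst z)\<^sup>2) *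
           indicator ({2 * l - r<..<l} \<times> {r<..<2 * r - l}) z \<partial>(lborel \<Otimes>\<^sub>M lborel))"
proof -
  define h where "h = r - l"
  have h: "h > 0" using assms by (simp add: h_def)
  let ?R = "{2 * l - r<..<l} \<times> {r<..<2 * r - l}"
  have "emeasure (lborel \<Otimes>\<^sub>M lborel) ?R = ennreal (h * h)"
    using assms by (simp add: lborel.emeasure_pair_measure_Times h_def ennreal_mult)
  then have "ennreal (f l r) = 9 * (ennreal (f l r) * ennreal (1 / (3 * h)\<^sup>2) * emeasure (lborel \<Otimes>\<^sub>M lborel) ?R)"
    using h nonneg[of l r] assms
    by (simp add: ennreal_mult[symmetric] ennreal_numeral[symmetric] power2_eq_square del: ennreal_numeral)
  also have "\<dots> = 9 * (\<integral>\<^sup>+ z. ennreal (f l r) * ennreal (1 / (3 * h)\<^sup>2) * indicator ?R z \<partial>(lborel \<Otimes>\<^sub>M lborel))"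
    by (subst nn_integral_cmult_indicator) (auto simp: pair_measureI)
  also have "\<dots> \<le> 9 * (\<integral>\<^sup>+ z. ennreal (f l r) * ennreal (1 / (snd z - fst z)\<^sup>2) * indicator ?R z \<partial>(lborel \<Otimes>\<^sub>M lborel))"
  proof (intro mult_left_mono nn_integral_mono)
    fix z :: "real \<times> real"
    have "1 / (3 * h)\<^sup>2 \<le> 1 / (snd z - fst z)\<^sup>2" if "z \<in> ?R"
    proof -
      have "0 < snd z - fst z" "snd z - fst z \<le> 3 * h" using that assms(1) by (auto simp: h_def)
      then show ?thesis by (intro divide_left_mono power_mono) auto
    qed
    then show "ennreal (f l r) * ennreal (1 / (3 * h)\<^sup>2) * indicator ?R z
        \<le> ennreal (f l r) * ennreal (1 / (snd z - fst z)\<^sup>2) * indicator ?R z"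
      by (cases "z \<in> ?R") (auto intro!: mult_left_mono ennreal_leI)
  qed simp_all
  finally show ?thesis .
qed

text \<open>On each square the extension dominates the cost of its deletion, and at most six squares overlap:
  \<open>54 = 9 * 6\<close>.\<close>

lemma sum_le_plane_integral:
  fixes l r :: "'i \<Rightarrow> real"
  assumes fin: "finite U"
    and lr: "\<And>u. u \<in> U \<Longrightarrow> a \<le> l u \<and> l u < r u \<and> r u \<le> b \<and> r u - l u \<le> d"
    and overlap: "\<And>s t. card {u \<in> U. s < l u \<and> r u < t \<and> t - s < 3 * (r u - l u)} \<le> 6"
  shows "(\<Sum>u\<in>U. ennreal (f (l u) (r u))) \<le> 54 * plane_integral f a b d"
proof -
  define R where "R u = {2 * l u - r u<..<l u} \<times> {r u<..<2 * r u - l u}" for u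
  define \<phi> where "\<phi> u z = ennreal (f (l u) (r u)) * ennreal (1 / (snd z - fst z)\<^sup>2) * indicator (R u) z" for u z
  have [measurable]: "R u \<in> sets (lborel \<Otimes>\<^sub>M lborel)" for u unfolding R_def by (intro pair_measureI) auto
  have [measurable]: "\<phi> u \<in> borel_measurable (lborel \<Otimes>\<^sub>M lborel)" for u unfolding \<phi>_def by measurable
  have "(\<Sum>u\<in>U. ennreal (f (l u) (r u))) \<le> (\<Sum>u\<in>U. 9 * (\<integral>\<^sup>+ z. \<phi> u z \<partial>(lborel \<Otimes>\<^sub>M lborel)))"
    unfolding \<phi>_def R_def using lr by (intro sum_mono le_integral_over_square) auto
  also have "\<dots> = 9 * (\<integral>\<^sup>+ z. (\<Sum>u\<in>U. \<phi> u z) \<partial>(lborel \<Otimes>\<^sub>M lborel))"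
    by (simp add: nn_integral_sum sum_distrib_left)
  also have "\<dots> \<le> 9 * (\<integral>\<^sup>+ z. 6 * band_density f a b d z \<partial>(lborel \<Otimes>\<^sub>M lborel))"
  proof (intro mult_left_mono nn_integral_mono)
    fix z :: "real \<times> real"
    define s t where "s = fst z" and "t = snd z"
    have z: "z = (s, t)" by (simp add: s_def t_def)
    define V where "V = {u \<in> U. z \<in> R u}"
    have V: "V \<subseteq> {u \<in> U. s < l u \<and> r u < t \<and> t - s < 3 * (r u - l u)}"
    proof
      fix u assume "u \<in> V"
      then have "u \<in> U" "2 * l u - r u < s" "s < l u" "r u < t" "t < 2 * r u - l u"
        by (simp_all add: V_def R_def z)
      then show "u \<in> {u \<in> U. s < l u \<and> r u < t \<and> t - s < 3 * (r u - l u)}" by simp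
    qed
    then have cV: "card V \<le> 6"
      using card_mono[OF _ V] overlap[of s t] fin by simp
    have "\<phi> u z \<le> band_density f a b d z" if u: "u \<in> V" for u
    proof -
      have uR: "u \<in> U" "2 * l u - r u < s" "s < l u" "r u < t" "t < 2 * r u - l u"
        using u by (simp_all add: V_def R_def z)
      have "z \<in> band a b d" using uR lr[OF uR(1)] by (auto simp: band_def z)
      moreover have "z \<in> R u" using u by (simp add: V_def)
      moreover have "ennreal (f (l u) (r u)) \<le> extension f a b z"
        unfolding z using uR lr[OF uR(1)] by (intro le_extension) auto
      ultimately show ?thesis
        by (simp add: \<phi>_def band_density_def mult_right_mono)
    qed
    then have "(\<Sum>u\<in>V. \<phi> u z) \<le> of_nat (card V) * band_density f a b d z"
      by (rule sum_bounded_above)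
    also have "\<dots> \<le> of_nat 6 * band_density f a b d z"
      using cV by (intro mult_right_mono) (simp_all only: of_nat_le_iff zero_le)
    also have "(\<Sum>u\<in>V. \<phi> u z) = (\<Sum>u\<in>U. \<phi> u z)"
      using fin by (intro sum.mono_neutral_left) (auto simp: V_def \<phi>_def)
    finally show "(\<Sum>u\<in>U. \<phi> u z) \<le> 6 * band_density f a b d z" by simp
  qed simp_all
  also have "\<dots> = 54 * plane_integral f a b d"
    by (simp add: plane_integral_def nn_integral_cmult mult.assoc[symmetric])
  finally show ?thesis .
qed

definition truncated :: "real \<Rightarrow> real \<Rightarrow> real \<Rightarrow> real" where
  "truncated d s t = f s t * of_bool (t < s + 3 * d)"

lemma band_density_le:
  assumes "d > 0"
  shows "band_density f a b d (s, t)
    \<le> ennreal (truncated d (max s a) (min t b)) * ennreal (1 / (t - s)\<^sup>2)"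
proof (cases "(s, t) \<in> band a b d \<and> a < t \<and> s < b")
  case True
  then have st: "s < t" "t < s + 3 * d" "a < t" "s < b" by (auto simp: band_def)
  have "extension f a b (s, t) \<le> ennreal (f (max s a) (min t b))" by (rule extension_le)
  (* moving s and t into [a, b] shortens the interval, so the truncation is inactive *)
  also have "f (max s a) (min t b) = truncated d (max s a) (min t b)"
    using st by (auto simp: truncated_def)
  finally have le: "extension f a b (s, t) \<le> ennreal (truncated d (max s a) (min t b))" .
  have "band_density f a b d (s, t) \<le> extension f a b (s, t) * ennreal (1 / (t - s)\<^sup>2)"
    by (auto simp: band_density_def split: split_indicator)
  also have "\<dots> \<le> ennreal (truncated d (max s a) (min t b)) * ennreal (1 / (t - s)\<^sup>2)"
    by (intro mult_right_mono le) auto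
  finally show ?thesis .
next
  case False
  then have "band_density f a b d (s, t) = 0"
    using extension_eq_0[of t s] by (auto simp: band_density_def split: split_indicator)
  then show ?thesis by simp
qed

lemma nn_integral_inverse_square_le:
  fixes c h t :: real
  assumes "c < t" "h \<ge> 0"
  shows "(\<integral>\<^sup>+ s. ennreal (1 / (t - s)\<^sup>2) * indicator {c - h..c} s \<partial>lborel) \<le> ennreal (1 / (t - c))"
proof -
  have "(\<integral>\<^sup>+ s. ennreal (1 / (t - s)\<^sup>2) * indicator {c - h..c} s \<partial>lborel)
      = ennreal (1 / (t - c) - 1 / (t - (c - h)))"
  proof (rule nn_integral_FTC_Icc)
    fix s assume "s \<in> {c - h..c}"
    then show "((\<lambda>s. 1 / (t - s)) has_real_derivative 1 / (t - s)\<^sup>2) (at s)"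
      using assms by (auto intro!: derivative_eq_intros simp: power2_eq_square)
  qed (use assms in auto)
  also have "\<dots> \<le> ennreal (1 / (t - c))" using assms by (intro ennreal_leI) simp
  finally show ?thesis .
qed

lemma nn_integral_inverse_square_le':
  fixes c h s :: real
  assumes "s < c" "h \<ge> 0"
  shows "(\<integral>\<^sup>+ t. ennreal (1 / (t - s)\<^sup>2) * indicator {c..c + h} t \<partial>lborel) \<le> ennreal (1 / (c - s))"
proof -
  have "(\<integral>\<^sup>+ t. ennreal (1 / (t - s)\<^sup>2) * indicator {c..c + h} t \<partial>lborel)
      = ennreal (- 1 / (c + h - s) - (- 1 / (c - s)))"
  proof (rule nn_integral_FTC_Icc)
    fix t assume "t \<in> {c..c + h}"
    then show "((\<lambda>t. - 1 / (t - s)) has_real_derivative 1 / (t - s)\<^sup>2) (at t)"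
      using assms by (auto intro!: derivative_eq_intros simp: power2_eq_square)
  qed (use assms in auto)
  also have "\<dots> \<le> ennreal (1 / (c - s))" using assms by (intro ennreal_leI) simp
  finally show ?thesis .
qed

text \<open>The plane is cut along \<open>s = a\<close> and \<open>t = b\<close>.  In the half-strips outside \<open>[a, b]\<close> the bound
  \<open>f a t\<close> or \<open>f s b\<close> on the extension is free of the outer coordinate, and integrating
  \<open>1 / (t - s)^2\<close> over that coordinate leaves \<open>1 / (t - a)\<close> or \<open>1 / (b - s)\<close>; in the corner the integrand is at most \<open>f a b / (b - a)^2\<close> on a set of
  area \<open>(b - a)^2\<close>.\<close>

lemma plane_integral_le_I_fun:
  assumes d: "d > 0"
  shows "plane_integral f a b d \<le> I_fun (truncated d) a b"
proof -
  let ?K = "band_density f a b d" and ?g = "truncated d"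
  let ?P = "lborel \<Otimes>\<^sub>M lborel :: (real \<times> real) measure"
  define A1 A2 A3 A4 where "A1 = {a..} \<times> {..b}" and "A2 = {..<a} \<times> {..b}"
    and "A3 = {a..} \<times> {b<..}" and "A4 = {..<a} \<times> {b<..}"
  note A_defs = A1_def A2_def A3_def A4_def
  have [measurable]: "A1 \<in> sets ?P" "A2 \<in> sets ?P" "A3 \<in> sets ?P" "A4 \<in> sets ?P"
    by (auto simp: A_defs intro!: pair_measureI)
  have outside: "?K (s, t) = 0" if "t \<le> a \<or> b \<le> s \<or> s \<le> 2 * a - b \<or> 2 * b - a \<le> t \<or> t \<le> s" for s t
    using that extension_eq_0[of t s] by (auto simp: band_density_def band_def)
  have K: "?K (s, t) \<le> ennreal (?g (max s a) (min t b)) * ennreal (1 / (t - s)\<^sup>2)" for s t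
    by (rule band_density_le[OF d])
  have "plane_integral f a b d
      = (\<integral>\<^sup>+ z. ?K z * indicator A1 z + ?K z * indicator A2 z + ?K z * indicator A3 z
              + ?K z * indicator A4 z \<partial>?P)"
    unfolding plane_integral_def
    by (intro nn_integral_cong) (auto simp: A_defs split: split_indicator)
  also have "\<dots> = (\<integral>\<^sup>+ z. ?K z * indicator A1 z \<partial>?P) + (\<integral>\<^sup>+ z. ?K z * indicator A2 z \<partial>?P)
        + (\<integral>\<^sup>+ z. ?K z * indicator A3 z \<partial>?P) + (\<integral>\<^sup>+ z. ?K z * indicator A4 z \<partial>?P)"
    by (simp add: nn_integral_add)
  also have "\<dots> \<le> (\<integral>\<^sup>+ s \<in> {a<..<b}. (\<integral>\<^sup>+ t \<in> {s<..<b}. ennreal (?g s t / (t - s)\<^sup>2) \<partial>lborel) \<partial>lborel)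
     + (\<integral>\<^sup>+ t \<in> {a<..<b}. ennreal (?g a t / (t - a)) \<partial>lborel)
     + (\<integral>\<^sup>+ s \<in> {a<..<b}. ennreal (?g s b / (b - s)) \<partial>lborel)
     + ennreal (?g a b)"
  proof (intro add_mono)
    have "(\<integral>\<^sup>+ z. ?K z * indicator A1 z \<partial>?P) = (\<integral>\<^sup>+ s. \<integral>\<^sup>+ t. ?K (s, t) * indicator A1 (s, t) \<partial>lborel \<partial>lborel)"
      by (rule lborel.nn_integral_fst[symmetric]) measurable
    also have "\<dots> \<le> (\<integral>\<^sup>+ s \<in> {a<..<b}. (\<integral>\<^sup>+ t \<in> {s<..<b}. ennreal (?g s t / (t - s)\<^sup>2) \<partial>lborel) \<partial>lborel)"
    proof (rule nn_integral_mono_AE, use AE_lborel_singleton[of a] in eventually_elim)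
      case (elim s)
      show ?case
      proof (cases "s \<in> {a<..<b}")
        case True
        have "(\<integral>\<^sup>+ t. ?K (s, t) * indicator A1 (s, t) \<partial>lborel)
            \<le> (\<integral>\<^sup>+ t. ennreal (?g s t / (t - s)\<^sup>2) * indicator {s<..<b} t \<partial>lborel)"
        proof (rule nn_integral_mono_AE, use AE_lborel_singleton[of b] in eventually_elim)
          case (elim t)
          then show ?case
            using K[of s t] outside[of t s] True
            by (cases "s < t \<and> t < b") (auto simp: A_defs ennreal_mult''[symmetric] split: split_indicator)
        qed
        then show ?thesis using True by simp
      next
        case False
        then have "?K (s, t) * indicator A1 (s, t) = 0" for t
          using elim outside[of t s] by (auto simp: A_defs split: split_indicator)
        then show ?thesis by (simp only: nn_integral_const mult_zero_left zero_le)
      qed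
    qed
    finally show "(\<integral>\<^sup>+ z. ?K z * indicator A1 z \<partial>?P)
      \<le> (\<integral>\<^sup>+ s \<in> {a<..<b}. (\<integral>\<^sup>+ t \<in> {s<..<b}. ennreal (?g s t / (t - s)\<^sup>2) \<partial>lborel) \<partial>lborel)" .
  next
    have "(\<integral>\<^sup>+ z. ?K z * indicator A2 z \<partial>?P) = (\<integral>\<^sup>+ t. \<integral>\<^sup>+ s. ?K (s, t) * indicator A2 (s, t) \<partial>lborel \<partial>lborel)"
      by (rule lborel_pair.nn_integral_snd[symmetric]) measurable
    also have "\<dots> \<le> (\<integral>\<^sup>+ t \<in> {a<..<b}. ennreal (?g a t / (t - a)) \<partial>lborel)"
    proof (rule nn_integral_mono_AE, use AE_lborel_singleton[of b] in eventually_elim)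
      case (elim t)
      show ?case
      proof (cases "t \<in> {a<..<b}")
        case True
        have "(\<integral>\<^sup>+ s. ?K (s, t) * indicator A2 (s, t) \<partial>lborel)
            \<le> (\<integral>\<^sup>+ s. ennreal (?g a t) * (ennreal (1 / (t - s)\<^sup>2) * indicator {a - (b - a)..a} s) \<partial>lborel)"
        proof (rule nn_integral_mono)
          fix s
          show "?K (s, t) * indicator A2 (s, t)
              \<le> ennreal (?g a t) * (ennreal (1 / (t - s)\<^sup>2) * indicator {a - (b - a)..a} s)"
            using K[of s t] outside[of t s] True
            by (cases "2 * a - b < s \<and> s < a") (auto simp: A_defs split: split_indicator)
        qed
        also have "\<dots> = ennreal (?g a t) * (\<integral>\<^sup>+ s. ennreal (1 / (t - s)\<^sup>2) * indicator {a - (b - a)..a} s \<partial>lborel)"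
          by (rule nn_integral_cmult) measurable
        also have "\<dots> \<le> ennreal (?g a t) * ennreal (1 / (t - a))"
          using True ab by (intro mult_left_mono nn_integral_inverse_square_le) auto
        also have "\<dots> = ennreal (?g a t / (t - a)) * indicator {a<..<b} t"
          using True by (simp add: ennreal_mult''[symmetric])
        finally show ?thesis .
      next
        case False
        then have "?K (s, t) * indicator A2 (s, t) = 0" for s
          using elim outside[of t s] by (auto simp: A_defs split: split_indicator)
        then show ?thesis by (simp only: nn_integral_const mult_zero_left zero_le)
      qed
    qed
    finally show "(\<integral>\<^sup>+ z. ?K z * indicator A2 z \<partial>?P)
      \<le> (\<integral>\<^sup>+ t \<in> {a<..<b}. ennreal (?g a t / (t - a)) \<partial>lborel)" .
  next
    have "(\<integral>\<^sup>+ z. ?K z * indicator A3 z \<partial>?P) = (\<integral>\<^sup>+ s. \<integral>\<^sup>+ t. ?K (s, t) * indicator A3 (s, t) \<partial>lborel \<partial>lborel)"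
      by (rule lborel.nn_integral_fst[symmetric]) measurable
    also have "\<dots> \<le> (\<integral>\<^sup>+ s \<in> {a<..<b}. ennreal (?g s b / (b - s)) \<partial>lborel)"
    proof (rule nn_integral_mono_AE, use AE_lborel_singleton[of a] in eventually_elim)
      case (elim s)
      show ?case
      proof (cases "s \<in> {a<..<b}")
        case True
        have "(\<integral>\<^sup>+ t. ?K (s, t) * indicator A3 (s, t) \<partial>lborel)
            \<le> (\<integral>\<^sup>+ t. ennreal (?g s b) * (ennreal (1 / (t - s)\<^sup>2) * indicator {b..b + (b - a)} t) \<partial>lborel)"
        proof (rule nn_integral_mono)
          fix t
          show "?K (s, t) * indicator A3 (s, t)
              \<le> ennreal (?g s b) * (ennreal (1 / (t - s)\<^sup>2) * indicator {b..b + (b - a)} t)"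
            using K[of s t] outside[of t s] True
            by (cases "b < t \<and> t < 2 * b - a") (auto simp: A_defs split: split_indicator)
        qed
        also have "\<dots> = ennreal (?g s b) * (\<integral>\<^sup>+ t. ennreal (1 / (t - s)\<^sup>2) * indicator {b..b + (b - a)} t \<partial>lborel)"
          by (rule nn_integral_cmult) measurable
        also have "\<dots> \<le> ennreal (?g s b) * ennreal (1 / (b - s))"
          using True ab by (intro mult_left_mono nn_integral_inverse_square_le') auto
        also have "\<dots> = ennreal (?g s b / (b - s)) * indicator {a<..<b} s"
          using True by (simp add: ennreal_mult''[symmetric])
        finally show ?thesis .
      next
        case False
        then have "?K (s, t) * indicator A3 (s, t) = 0" for t
          using elim outside[of t s] by (auto simp: A_defs split: split_indicator)
        then show ?thesis by (simp only: nn_integral_const mult_zero_left zero_le)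
      qed
    qed
    finally show "(\<integral>\<^sup>+ z. ?K z * indicator A3 z \<partial>?P)
      \<le> (\<integral>\<^sup>+ s \<in> {a<..<b}. ennreal (?g s b / (b - s)) \<partial>lborel)" .
  next
    let ?C = "{2 * a - b<..<a} \<times> {b<..<2 * b - a}"
    have "(\<integral>\<^sup>+ z. ?K z * indicator A4 z \<partial>?P)
        \<le> (\<integral>\<^sup>+ z. ennreal (?g a b) * ennreal (1 / (b - a)\<^sup>2) * indicator ?C z \<partial>?P)"
    proof (rule nn_integral_mono, clarify)
      fix s t
      show "?K (s, t) * indicator A4 (s, t) \<le> ennreal (?g a b) * ennreal (1 / (b - a)\<^sup>2) * indicator ?C (s, t)"
      proof (cases "(s, t) \<in> ?C")
        case True
        then have "1 / (t - s)\<^sup>2 \<le> 1 / (b - a)\<^sup>2"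
          using ab by (intro divide_left_mono power_mono mult_pos_pos) auto
        then have "ennreal (?g a b) * ennreal (1 / (t - s)\<^sup>2) \<le> ennreal (?g a b) * ennreal (1 / (b - a)\<^sup>2)"
          by (intro mult_left_mono ennreal_leI) auto
        with K[of s t] True show ?thesis by (auto simp: A_defs split: split_indicator)
      next
        case False
        then show ?thesis using outside[of t s] by (auto simp: A_defs split: split_indicator)
      qed
    qed
    also have "\<dots> = ennreal (?g a b) * ennreal (1 / (b - a)\<^sup>2) * emeasure ?P ?C"
      by (rule nn_integral_cmult_indicator) (auto intro!: pair_measureI)
    also have "emeasure ?P ?C = ennreal ((b - a) * (b - a))"
      using ab by (simp add: lborel.emeasure_pair_measure_Times ennreal_mult)
    also have "ennreal (?g a b) * ennreal (1 / (b - a)\<^sup>2) * ennreal ((b - a) * (b - a)) = ennreal (?g a b)"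
      using ab by (simp add: ennreal_mult''[symmetric] power2_eq_square mult.assoc)
    finally show "(\<integral>\<^sup>+ z. ?K z * indicator A4 z \<partial>?P) \<le> ennreal (?g a b)" .
  qed
  also have "\<dots> = I_fun ?g a b" by (simp add: I_fun_def)
  finally show ?thesis .
qed

lemma I_fun_truncated_le: "I_fun (truncated d) a b \<le> I_fun f a b"
proof -
  have le: "truncated d s t \<le> f s t" if "a \<le> s" "s \<le> t" "t \<le> b" for s t
    using nonneg[OF that] by (simp add: truncated_def)
  show ?thesis
    unfolding I_fun_def
  proof (intro add_mono)
    show "(\<integral>\<^sup>+ s \<in> {a<..<b}. (\<integral>\<^sup>+ t \<in> {s<..<b}. ennreal (truncated d s t / (t - s)\<^sup>2) \<partial>lborel) \<partial>lborel)
        \<le> (\<integral>\<^sup>+ s \<in> {a<..<b}. (\<integral>\<^sup>+ t \<in> {s<..<b}. ennreal (f s t / (t - s)\<^sup>2) \<partial>lborel) \<partial>lborel)"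
    proof (rule nn_integral_mono)
      fix s
      have "(\<integral>\<^sup>+ t \<in> {s<..<b}. ennreal (truncated d s t / (t - s)\<^sup>2) \<partial>lborel)
          \<le> (\<integral>\<^sup>+ t \<in> {s<..<b}. ennreal (f s t / (t - s)\<^sup>2) \<partial>lborel)" if "s \<in> {a<..<b}"
        using that le
        by (intro nn_integral_mono) (auto split: split_indicator intro!: ennreal_leI divide_right_mono)
      then show "(\<integral>\<^sup>+ t \<in> {s<..<b}. ennreal (truncated d s t / (t - s)\<^sup>2) \<partial>lborel) * indicator {a<..<b} s
          \<le> (\<integral>\<^sup>+ t \<in> {s<..<b}. ennreal (f s t / (t - s)\<^sup>2) \<partial>lborel) * indicator {a<..<b} s"
        by (simp split: split_indicator)
    qed
  next
    show "(\<integral>\<^sup>+ t \<in> {a<..<b}. ennreal (truncated d a t / (t - a)) \<partial>lborel)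
        \<le> (\<integral>\<^sup>+ t \<in> {a<..<b}. ennreal (f a t / (t - a)) \<partial>lborel)"
      using le by (intro nn_integral_mono) (auto split: split_indicator intro!: ennreal_leI divide_right_mono)
  next
    show "(\<integral>\<^sup>+ s \<in> {a<..<b}. ennreal (truncated d s b / (b - s)) \<partial>lborel)
        \<le> (\<integral>\<^sup>+ s \<in> {a<..<b}. ennreal (f s b / (b - s)) \<partial>lborel)"
      using le by (intro nn_integral_mono) (auto split: split_indicator intro!: ennreal_leI divide_right_mono)
  next
    show "ennreal (truncated d a b) \<le> ennreal (f a b)"
      using le ab by (intro ennreal_leI) auto
  qed
qed

text \<open>Dominated convergence with the band for \<open>d = b - a\<close>, which is already the widest one: the overhang
  bounds force \<open>t - s < 3 * (b - a)\<close>.\<close>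

lemma plane_integral_tendsto_0:
  assumes fin: "I_fun f a b < \<infinity>" and lim: "d \<longlonglongrightarrow> 0"
  shows "(\<lambda>k. plane_integral f a b (d k)) \<longlonglongrightarrow> 0"
proof -
  have "plane_integral f a b (b - a) \<le> I_fun f a b"
    using ab plane_integral_le_I_fun[of "b - a"] I_fun_truncated_le[of "b - a"] by auto
  then have w: "(\<integral>\<^sup>+ z. band_density f a b (b - a) z \<partial>(lborel \<Otimes>\<^sub>M lborel)) < \<infinity>"
    using fin by (simp add: plane_integral_def)
  have "(\<lambda>k. \<integral>\<^sup>+ z. band_density f a b (d k) z \<partial>(lborel \<Otimes>\<^sub>M lborel)) \<longlonglongrightarrow> (\<integral>\<^sup>+ (z :: real \<times> real). 0 \<partial>(lborel \<Otimes>\<^sub>M lborel))"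
  proof (rule nn_integral_dominated_convergence[where u = "\<lambda>k. band_density f a b (d k)"
        and u' = "\<lambda>z. 0" and w = "band_density f a b (b - a)"])
    have "band_density f a b (d k) z \<le> band_density f a b (b - a) z" for k z
      by (auto simp: band_density_def band_def split: split_indicator intro!: mult_left_mono)
    then show "AE z in lborel \<Otimes>\<^sub>M lborel. band_density f a b (d k) z \<le> band_density f a b (b - a) z" for k
      by simp
    have "(\<lambda>k. band_density f a b (d k) (s, t)) \<longlonglongrightarrow> 0" for s t
    proof (rule tendsto_eventually)
      show "eventually (\<lambda>k. band_density f a b (d k) (s, t) = 0) sequentially"
      proof (cases "s < t")
        case True
        then have "eventually (\<lambda>k. d k < (t - s) / 3) sequentially"
          by (intro order_tendstoD(2)[OF lim]) simp
        then show ?thesis by eventually_elim (auto simp: band_density_def band_def)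
      qed (simp add: band_density_def band_def)
    qed
    then show "AE z in lborel \<Otimes>\<^sub>M lborel. (\<lambda>k. band_density f a b (d k) z) \<longlonglongrightarrow> 0"
      by (intro AE_I2) auto
  qed (use w in auto)
  then show ?thesis by (simp add: plane_integral_def)
qed

end

section \<open>Partitions as finite sets\<close>

lemma partition_less:
  assumes "is_partition a b n t" "i < j" "j \<le> n"
  shows "t i < t j"
  using assms(2,3)
proof (induction j)
  case (Suc j)
  have "t j < t (Suc j)"
    using assms(1) Suc.prems(2) by (auto simp: is_partition_def dest: bspec[of _ _ "Suc j"])
  then show ?case using Suc by (cases "i = j") auto
qed simp

lemma partition_points:
  assumes part: "is_partition a b n t" and "a < b"
  shows "a \<in> t ` {..n}" "b \<in> t ` {..n}" "t ` {..n} \<subseteq> {a..b}" "0 < n"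
proof -
  have ends: "t 0 = a" "t n = b" using part by (auto simp: is_partition_def)
  then show "a \<in> t ` {..n}" "b \<in> t ` {..n}" by force+
  show "0 < n" using ends \<open>a < b\<close> by (cases n) auto
  have "a \<le> t i \<and> t i \<le> b" if "i \<le> n" for i
    using partition_less[OF part, of 0 i] partition_less[OF part, of i n] ends that
    by (cases "i = 0"; cases "i = n") auto
  then show "t ` {..n} \<subseteq> {a..b}" by auto
qed

lemma partition_gap_le_mesh:
  assumes "i < n" shows "t (Suc i) - t i \<le> mesh n t"
proof -
  have "t (Suc i) - t (Suc i - 1) \<le> mesh n t"
    unfolding mesh_def
  proof (rule Max_ge)
    show "t (Suc i) - t (Suc i - 1) \<in> (\<lambda>i. t i - t (i - 1)) ` {1..n}"
      using assms by (rule_tac image_eqI[of _ _ "Suc i"]) auto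
  qed simp
  then show ?thesis by simp
qed

lemma partition_mesh_pos:
  assumes "is_partition a b n t" "a < b" shows "0 < mesh n t"
  using partition_gap_le_mesh[of 0 n t] partition_less[OF assms(1), of 0 1] partition_points(4)[OF assms]
  by simp

lemma forward_sum_eq_set_forward_sum:
  assumes part: "is_partition a b n t" and "a < b"
  shows "forward_sum Y X n t \<omega> = set_forward_sum (\<lambda>s. Y s \<omega>) (\<lambda>s. X s \<omega>) b (t ` {..n})"
proof -
  note less = partition_less[OF part]
  have tn: "t n = b" using part by (simp add: is_partition_def)
  have inj: "inj_on t {..<n}"
  proof (rule linorder_inj_onI)
    fix i j assume "i < j" "j \<in> {..<n}"
    then show "t i \<noteq> t j" using less[of i j] by auto
  qed auto
  have eq: "t ` {..n} - {b} = t ` {..<n}"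
  proof -
    have "{..n} = insert n {..<n}" by auto
    moreover have "b \<notin> t ` {..<n}"
    proof
      assume "b \<in> t ` {..<n}"
      then obtain i where "i < n" "t i = b" by auto
      then show False using less[of i n] tn by simp
    qed
    ultimately show ?thesis by (auto simp: tn)
  qed
  have succ: "next_point (t ` {..n}) (t i) = t (Suc i)" if "i < n" for i
  proof (rule next_point_eqI)
    fix z assume "z \<in> t ` {..n}" "t i < z"
    then obtain j where j: "j \<le> n" "z = t j" "t i < t j" by auto
    have "i < j"
    proof (rule ccontr)
      assume "\<not> i < j"
      then have "j = i \<or> j < i" by auto
      then show False using j less[of j i] that by auto
    qed
    then show "t (Suc i) \<le> z"
      using less[of "Suc i" j] j by (cases "Suc i = j") auto
  qed (use that less in auto)
  have "set_forward_sum (\<lambda>s. Y s \<omega>) (\<lambda>s. X s \<omega>) b (t ` {..n})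
      = (\<Sum>i<n. Y (t i) \<omega> * (X (t (Suc i)) \<omega> - X (t i) \<omega>))"
    unfolding set_forward_sum_def eq by (subst sum.reindex[OF inj]) (simp add: succ)
  also have "\<dots> = forward_sum Y X n t \<omega>"
    unfolding forward_sum_def by (simp add: sum.atLeast1_atMost_eq)
  finally show ?thesis by simp
qed

definition uniform_partition :: "real \<Rightarrow> real \<Rightarrow> nat \<Rightarrow> nat \<Rightarrow> real" where
  "uniform_partition a b n i = a + (b - a) * (real i / real n)"

lemma is_partition_uniform:
  assumes "a < b" "n > 0" shows "is_partition a b n (uniform_partition a b n)"
  using assms by (auto simp: is_partition_def uniform_partition_def divide_strict_right_mono)

lemma mesh_uniform_tendsto_0:
  assumes "a < b"
  shows "(\<lambda>k. mesh (Suc k) (uniform_partition a b (Suc k))) \<longlonglongrightarrow> 0"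
proof -
  have "uniform_partition a b (Suc k) i - uniform_partition a b (Suc k) (i - 1) = (b - a) / real (Suc k)"
    if i: "i \<in> {1..Suc k}" for i k
  proof -
    obtain j where j: "i = Suc j" using i by (cases i) auto
    have "uniform_partition a b (Suc k) i - uniform_partition a b (Suc k) (i - 1)
        = (b - a) * (real (Suc j) / real (Suc k) - real j / real (Suc k))"
      unfolding j uniform_partition_def right_diff_distrib by simp
    also have "real (Suc j) / real (Suc k) - real j / real (Suc k) = 1 / real (Suc k)"
      unfolding diff_divide_distrib[symmetric] by simp
    finally show ?thesis by simp
  qed
  then have "(\<lambda>i. uniform_partition a b (Suc k) i - uniform_partition a b (Suc k) (i - 1)) ` {1..Suc k}
      = {(b - a) / real (Suc k)}" for k
    by (auto simp: image_iff)
  then have "mesh (Suc k) (uniform_partition a b (Suc k)) = (b - a) / real (Suc k)" for k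
    by (simp add: mesh_def)
  moreover have "(\<lambda>k. (b - a) / real (Suc k)) \<longlonglongrightarrow> 0"
    by (rule LIMSEQ_Suc[OF lim_const_over_n])
  ultimately show ?thesis by simp
qed

section \<open>Comparison of integral sums and the theorem\<close>

locale forward_integral = monotone_interval_function f a b
  for f :: "real \<Rightarrow> real \<Rightarrow> real" and a b :: real +
  fixes M :: "'w measure" and p :: real and X Y :: "real \<Rightarrow> 'w \<Rightarrow> real"
  assumes p: "p \<ge> 1"
    and X_meas: "\<And>t. t \<in> {a..b} \<Longrightarrow> X t \<in> borel_measurable M"
    and Y_meas: "\<And>t. t \<in> {a..b} \<Longrightarrow> Y t \<in> borel_measurable M"
    and increment_bound: "\<And>s u t. a \<le> s \<Longrightarrow> s < u \<Longrightarrow> u < t \<Longrightarrow> t \<le> b \<Longrightarrow>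
           Lp_norm M p (\<lambda>\<omega>. (Y u \<omega> - Y s \<omega>) * (X t \<omega> - X u \<omega>)) \<le> ennreal (f s t)"
begin

abbreviation point_sum :: "real set \<Rightarrow> 'w \<Rightarrow> real" where
  "point_sum P \<omega> \<equiv> set_forward_sum (\<lambda>s. Y s \<omega>) (\<lambda>s. X s \<omega>) b P"

lemma measurable_point_sum:
  assumes "finite P" "P \<subseteq> {a..b}" "b \<in> P"
  shows "point_sum P \<in> borel_measurable M"
  unfolding set_forward_sum_def
proof (intro borel_measurable_sum borel_measurable_times borel_measurable_diff X_meas Y_meas)
  fix u assume u: "u \<in> P - {b}"
  then show "u \<in> {a..b}" using assms by auto
  then have "u < b" using u by (simp add: less_le)
  then show "next_point P u \<in> {a..b}" using next_point(1)[OF assms(1,3) \<open>u < b\<close>] assms(2) by auto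
qed (use assms in auto)

lemma measurable_forward_sum:
  assumes "is_partition a b n t"
  shows "forward_sum Y X n t \<in> borel_measurable M"
  using measurable_point_sum[of "t ` {..n}"] partition_points[OF assms ab]
  by (simp add: forward_sum_eq_set_forward_sum[OF assms ab, abs_def] cong: measurable_cong)

text \<open>The neighbours at a deletion lie in one interval of the coarse partition, because its points are
  never deleted; hence all gaps are at most its mesh.\<close>

lemma refinement_bound:
  assumes part: "is_partition a b n t" and P: "finite P" "t ` {..n} \<subseteq> P" "P \<subseteq> {a..b}"
  shows "Lp_norm M p (\<lambda>\<omega>. point_sum P \<omega> - forward_sum Y X n t \<omega>) \<le> 54 * plane_integral f a b (mesh n t)"
proof -
  define Q where "Q = t ` {..n}"
  note pts = partition_points[OF part ab, folded Q_def]
  have fQ: "finite Q" by (simp add: Q_def)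
  obtain l r where
    tel: "\<And>y x. set_forward_sum y x b P - set_forward_sum y x b Q
             = (\<Sum>u\<in>P - Q. (y u - y (l u)) * (x (r u) - x u))"
    and bet: "\<And>u. u \<in> P - Q \<Longrightarrow> l u < u \<and> u < r u \<and> (\<forall>q\<in>Q. q < u \<longrightarrow> q \<le> l u) \<and> (\<forall>q\<in>Q. u < q \<longrightarrow> r u \<le> q)"
    and overlap: "\<And>s t. card {u \<in> P - Q. s < l u \<and> r u < t \<and> t - s < 3 * (r u - l u)} \<le> 6"
    using greedy_thinning[of P Q a b] P pts(1,2) unfolding Q_def[symmetric] by blast
  have ends: "a < u" "u < b" if "u \<in> P - Q" for u
    using that P(3) pts(1,2) by (force simp: less_le)+
  have lr: "a \<le> l u \<and> l u < u \<and> u < r u \<and> r u \<le> b \<and> r u - l u \<le> mesh n t" if u: "u \<in> P - Q" for u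
  proof -
    note prev = prev_point[OF fQ pts(1) ends(1)[OF u]]
    obtain i where i: "i \<le> n" "prev_point Q u = t i" using prev(1) by (auto simp: Q_def)
    have "t n = b" using part by (simp add: is_partition_def)
    then have "i < n" using i prev(2) ends(2)[OF u] by (cases "i = n") auto
    then have in_Q: "t (Suc i) \<in> Q" by (auto simp: Q_def)
    have "t i < t (Suc i)" using partition_less[OF part, of i "Suc i"] \<open>i < n\<close> by simp
    then have "\<not> t (Suc i) < u" using prev_point(3)[OF fQ in_Q, of u] i by auto
    then have "u < t (Suc i)" using in_Q u by (cases "t (Suc i) = u") auto
    then have "r u \<le> t (Suc i)" "t i \<le> l u" using bet[OF u] in_Q prev i by auto
    then have "r u - l u \<le> mesh n t" using partition_gap_le_mesh[OF \<open>i < n\<close>, of t] by linarith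
    then show ?thesis using bet[OF u] pts(1,2) ends[OF u] by auto
  qed
  have "Lp_norm M p (\<lambda>\<omega>. point_sum P \<omega> - forward_sum Y X n t \<omega>)
      = Lp_norm M p (\<lambda>\<omega>. \<Sum>u\<in>P - Q. (Y u \<omega> - Y (l u) \<omega>) * (X (r u) \<omega> - X u \<omega>))"
    by (simp add: forward_sum_eq_set_forward_sum[OF part ab] Q_def[symmetric] tel)
  also have "\<dots> \<le> (\<Sum>u\<in>P - Q. Lp_norm M p (\<lambda>\<omega>. (Y u \<omega> - Y (l u) \<omega>) * (X (r u) \<omega> - X u \<omega>)))"
  proof (intro Lp_norm_sum_le borel_measurable_times borel_measurable_diff X_meas Y_meas p)
    fix u assume u: "u \<in> P - Q"
    show "u \<in> {a..b}" "l u \<in> {a..b}" "r u \<in> {a..b}" "u \<in> {a..b}"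
      using lr[OF u] ends[OF u] by auto
  qed (use P in auto)
  also have "\<dots> \<le> (\<Sum>u\<in>P - Q. ennreal (f (l u) (r u)))"
    using lr by (intro sum_mono increment_bound) auto
  also have "\<dots> \<le> 54 * plane_integral f a b (mesh n t)"
  proof (rule sum_le_plane_integral[OF _ _ overlap])
    show "finite (P - Q)" using P by simp
    show "a \<le> l u \<and> l u < r u \<and> r u \<le> b \<and> r u - l u \<le> mesh n t" if "u \<in> P - Q" for u
      using lr[OF that] by linarith
  qed
  finally show ?thesis .
qed

lemma two_partitions_bound:
  assumes p1: "is_partition a b n t" and p2: "is_partition a b m u"
  shows "Lp_norm M p (\<lambda>\<omega>. forward_sum Y X n t \<omega> - forward_sum Y X m u \<omega>)
    \<le> 54 * plane_integral f a b (mesh n t) + 54 * plane_integral f a b (mesh m u)"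
proof -
  define P where "P = t ` {..n} \<union> u ` {..m}"
  have P: "finite P" "P \<subseteq> {a..b}" "b \<in> P"
    using partition_points[OF p1 ab] partition_points[OF p2 ab] by (auto simp: P_def)
  have "Lp_norm M p (\<lambda>\<omega>. forward_sum Y X n t \<omega> - forward_sum Y X m u \<omega>)
      \<le> Lp_norm M p (\<lambda>\<omega>. forward_sum Y X n t \<omega> - point_sum P \<omega>)
        + Lp_norm M p (\<lambda>\<omega>. point_sum P \<omega> - forward_sum Y X m u \<omega>)"
    by (intro Lp_norm_diff_triangle measurable_forward_sum p1 p2 measurable_point_sum P p)
  also have "\<dots> \<le> 54 * plane_integral f a b (mesh n t) + 54 * plane_integral f a b (mesh m u)"
  proof (intro add_mono)
    have "Lp_norm M p (\<lambda>\<omega>. point_sum P \<omega> - forward_sum Y X n t \<omega>) \<le> 54 * plane_integral f a b (mesh n t)"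
      by (rule refinement_bound[OF p1 P(1) _ P(2)]) (simp add: P_def)
    then show "Lp_norm M p (\<lambda>\<omega>. forward_sum Y X n t \<omega> - point_sum P \<omega>) \<le> 54 * plane_integral f a b (mesh n t)"
      by (simp only: Lp_norm_diff_commute[of M p "forward_sum Y X n t" "point_sum P"])
    show "Lp_norm M p (\<lambda>\<omega>. point_sum P \<omega> - forward_sum Y X m u \<omega>) \<le> 54 * plane_integral f a b (mesh m u)"
      by (rule refinement_bound[OF p2 P(1) _ P(2)]) (simp add: P_def)
  qed
  finally show ?thesis .
qed

definition uniform_sum :: "nat \<Rightarrow> 'w \<Rightarrow> real" where
  "uniform_sum k = forward_sum Y X (Suc k) (uniform_partition a b (Suc k))"

definition uniform_error :: "nat \<Rightarrow> ennreal" where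
  "uniform_error k = 54 * plane_integral f a b (mesh (Suc k) (uniform_partition a b (Suc k)))"

lemma tendsto_54_plane_integral:
  assumes "I_fun f a b < \<infinity>" "d \<longlonglongrightarrow> 0"
  shows "(\<lambda>k. 54 * plane_integral f a b (d k)) \<longlonglongrightarrow> 0"
  using ennreal_tendsto_cmult[OF _ plane_integral_tendsto_0[OF assms], of 54] by simp

lemma uniform_error_tendsto_0: "I_fun f a b < \<infinity> \<Longrightarrow> uniform_error \<longlonglongrightarrow> 0"
  unfolding uniform_error_def[abs_def]
  by (intro tendsto_54_plane_integral mesh_uniform_tendsto_0 ab)

lemma measurable_uniform_sum: "uniform_sum k \<in> borel_measurable M"
  unfolding uniform_sum_def by (intro measurable_forward_sum is_partition_uniform ab) simp

text \<open>A limit along the uniform partitions alone controls every partition: compare with a uniform one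
  and let its mesh tend to \<open>0\<close>.\<close>

lemma limit_error_bound:
  assumes fin: "I_fun f a b < \<infinity>" and Z: "Z \<in> borel_measurable M"
    and lim: "(\<lambda>k. Lp_norm M p (\<lambda>\<omega>. Z \<omega> - uniform_sum k \<omega>)) \<longlonglongrightarrow> 0"
    and part: "is_partition a b n t"
  shows "Lp_norm M p (\<lambda>\<omega>. Z \<omega> - forward_sum Y X n t \<omega>) \<le> 54 * plane_integral f a b (mesh n t)"
proof (rule tendsto_lowerbound)
  show "(\<lambda>k. Lp_norm M p (\<lambda>\<omega>. Z \<omega> - uniform_sum k \<omega>)
           + (uniform_error k + 54 * plane_integral f a b (mesh n t)))
        \<longlonglongrightarrow> 54 * plane_integral f a b (mesh n t)"
    using tendsto_add[OF lim tendsto_add[OF uniform_error_tendsto_0[OF fin] tendsto_const]] by simp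
  have "Lp_norm M p (\<lambda>\<omega>. Z \<omega> - forward_sum Y X n t \<omega>)
      \<le> Lp_norm M p (\<lambda>\<omega>. Z \<omega> - uniform_sum k \<omega>)
           + (uniform_error k + 54 * plane_integral f a b (mesh n t))" for k
  proof -
    have "Lp_norm M p (\<lambda>\<omega>. Z \<omega> - forward_sum Y X n t \<omega>)
        \<le> Lp_norm M p (\<lambda>\<omega>. Z \<omega> - uniform_sum k \<omega>)
          + Lp_norm M p (\<lambda>\<omega>. uniform_sum k \<omega> - forward_sum Y X n t \<omega>)"
      by (intro Lp_norm_diff_triangle Z measurable_uniform_sum measurable_forward_sum part p)
    also have "Lp_norm M p (\<lambda>\<omega>. uniform_sum k \<omega> - forward_sum Y X n t \<omega>)
        \<le> uniform_error k + 54 * plane_integral f a b (mesh n t)"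
      unfolding uniform_sum_def uniform_error_def
      by (intro two_partitions_bound is_partition_uniform part ab) simp
    finally show ?thesis by simp
  qed
  then show "\<forall>\<^sub>F k in sequentially. Lp_norm M p (\<lambda>\<omega>. Z \<omega> - forward_sum Y X n t \<omega>)
      \<le> Lp_norm M p (\<lambda>\<omega>. Z \<omega> - uniform_sum k \<omega>)
           + (uniform_error k + 54 * plane_integral f a b (mesh n t))"
    by simp
qed simp

lemma uniform_sums_converge:
  assumes fin: "I_fun f a b < \<infinity>"
  shows "\<exists>Z\<in>borel_measurable M. (\<lambda>k. Lp_norm M p (\<lambda>\<omega>. Z \<omega> - uniform_sum k \<omega>)) \<longlonglongrightarrow> 0"
proof (rule Lp_complete[OF measurable_uniform_sum])
  fix e :: real assume e: "e > 0"
  then have "eventually (\<lambda>k. uniform_error k < ennreal (e / 2)) sequentially"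
    by (intro order_tendstoD(2)[OF uniform_error_tendsto_0[OF fin]]) simp
  then obtain N where N: "\<And>k. k \<ge> N \<Longrightarrow> uniform_error k < ennreal (e / 2)"
    by (auto simp: eventually_sequentially)
  have "Lp_norm M p (\<lambda>\<omega>. uniform_sum k \<omega> - uniform_sum m \<omega>) \<le> ennreal e" if "k \<ge> N" "m \<ge> N" for k m
  proof -
    have "Lp_norm M p (\<lambda>\<omega>. uniform_sum k \<omega> - uniform_sum m \<omega>) \<le> uniform_error k + uniform_error m"
      unfolding uniform_sum_def uniform_error_def
      by (intro two_partitions_bound is_partition_uniform ab) simp_all
    also have "\<dots> \<le> ennreal (e / 2) + ennreal (e / 2)"
      using N that by (intro add_mono less_imp_le) auto
    also have "\<dots> = ennreal e" using e by (simp add: ennreal_plus[symmetric] del: ennreal_plus)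
    finally show ?thesis .
  qed
  then show "\<exists>N. \<forall>k\<ge>N. \<forall>m\<ge>N. Lp_norm M p (\<lambda>\<omega>. uniform_sum k \<omega> - uniform_sum m \<omega>) \<le> ennreal e"
    by blast
qed (use p in simp)

lemma forward_integral_exists:
  assumes fin: "I_fun f a b < \<infinity>"
  shows "\<exists>Z. is_Lp_forward_integral M p Y X a b Z"
proof -
  obtain Z where Z: "Z \<in> borel_measurable M"
    and lim: "(\<lambda>k. Lp_norm M p (\<lambda>\<omega>. Z \<omega> - uniform_sum k \<omega>)) \<longlonglongrightarrow> 0"
    using uniform_sums_converge[OF fin] by blast
  have "(\<lambda>k. Lp_norm M p (\<lambda>\<omega>. Z \<omega> - forward_sum Y X (n k) (t k) \<omega>)) \<longlonglongrightarrow> 0"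
    if parts: "\<And>k. is_partition a b (n k) (t k)" and mesh: "(\<lambda>k. mesh (n k) (t k)) \<longlonglongrightarrow> 0" for n t
  proof (rule tendsto_sandwich[OF _ _ tendsto_const tendsto_54_plane_integral[OF fin mesh]])
    show "\<forall>\<^sub>F k in sequentially. Lp_norm M p (\<lambda>\<omega>. Z \<omega> - forward_sum Y X (n k) (t k) \<omega>)
            \<le> 54 * plane_integral f a b (mesh (n k) (t k))"
      using limit_error_bound[OF fin Z lim parts] by simp
  qed simp
  then have "is_Lp_forward_integral M p Y X a b Z"
    using Z by (simp add: is_Lp_forward_integral_def)
  then show ?thesis by (rule exI[of _ Z])
qed

lemma forward_integral_error:
  assumes fin: "I_fun f a b < \<infinity>" and Z: "is_Lp_forward_integral M p Y X a b Z"
    and part: "is_partition a b n t"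
  shows "Lp_norm M p (\<lambda>\<omega>. Z \<omega> - forward_sum Y X n t \<omega>) \<le> 54 * I_fun (truncated (mesh n t)) a b"
proof -
  have "(\<lambda>k. Lp_norm M p (\<lambda>\<omega>. Z \<omega> - uniform_sum k \<omega>)) \<longlonglongrightarrow> 0"
    using Z mesh_uniform_tendsto_0[OF ab] is_partition_uniform[OF ab]
    unfolding is_Lp_forward_integral_def uniform_sum_def
    by (auto dest!: spec[of _ Suc] spec[of _ "\<lambda>k. uniform_partition a b (Suc k)"])
  moreover have "Z \<in> borel_measurable M"
    using Z by (simp add: is_Lp_forward_integral_def)
  ultimately have "Lp_norm M p (\<lambda>\<omega>. Z \<omega> - forward_sum Y X n t \<omega>) \<le> 54 * plane_integral f a b (mesh n t)"
    by (intro limit_error_bound[OF fin _ _ part])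
  also have "\<dots> \<le> 54 * I_fun (truncated (mesh n t)) a b"
    using plane_integral_le_I_fun[OF partition_mesh_pos[OF part ab]] by (intro mult_left_mono) auto
  finally show ?thesis .
qed

end

theorem theorem2p1:
  fixes M :: "'w measure" and X Y :: "real \<Rightarrow> 'w \<Rightarrow> real"
    and a b p :: real and f :: "real \<Rightarrow> real \<Rightarrow> real"
  assumes "prob_space M" and "a < b" and "p \<ge> 1"
    and "\<And>t. t \<in> {a..b} \<Longrightarrow> X t \<in> borel_measurable M"
    and "\<And>t. t \<in> {a..b} \<Longrightarrow> Y t \<in> borel_measurable M"
    and "\<And>s s' t. a \<le> s \<Longrightarrow> s \<le> s' \<Longrightarrow> s' \<le> t \<Longrightarrow> t \<le> b \<Longrightarrow> f s' t \<le> f s t"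
    and "\<And>s t t'. a \<le> s \<Longrightarrow> s \<le> t \<Longrightarrow> t \<le> t' \<Longrightarrow> t' \<le> b \<Longrightarrow> f s t \<le> f s t'"
    and "\<And>t. t \<in> {a..b} \<Longrightarrow> f t t = 0"
    and "\<And>s u t. a \<le> s \<Longrightarrow> s < u \<Longrightarrow> u < t \<Longrightarrow> t \<le> b \<Longrightarrow>
           Lp_norm M p (\<lambda>\<omega>. (Y u \<omega> - Y s \<omega>) * (X t \<omega> - X u \<omega>)) \<le> ennreal (f s t)"
    and "I_fun f a b < \<infinity>"
  shows "(\<exists>Z. is_Lp_forward_integral M p Y X a b Z) \<and>
    (\<forall>Z. is_Lp_forward_integral M p Y X a b Z \<longrightarrow>
      (\<forall>n t. is_partition a b n t \<longrightarrow>
        Lp_norm M p (\<lambda>\<omega>. Z \<omega> - forward_sum Y X n t \<omega>)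
          \<le> 92 * I_fun (\<lambda>s t'. f s t' * of_bool (t' < s + 3 * mesh n t)) (t 0) (t n)))"
proof -
  interpret forward_integral f a b M p X Y
    by unfold_locales (rule assms; assumption)+
  show ?thesis
  proof (intro conjI allI impI)
    show "\<exists>Z. is_Lp_forward_integral M p Y X a b Z"
      by (rule forward_integral_exists[OF assms(10)])
  next
    fix Z n t
    assume Z: "is_Lp_forward_integral M p Y X a b Z" and part: "is_partition a b n t"
    have "Lp_norm M p (\<lambda>\<omega>. Z \<omega> - forward_sum Y X n t \<omega>) \<le> 54 * I_fun (truncated (mesh n t)) a b"
      by (rule forward_integral_error[OF assms(10) Z part])
    also have "\<dots> \<le> 92 * I_fun (truncated (mesh n t)) a b"
      by (intro mult_right_mono) auto
    also have "truncated (mesh n t) = (\<lambda>s t'. f s t' * of_bool (t' < s + 3 * mesh n t))"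
      by (simp add: fun_eq_iff truncated_def)
    finally have "Lp_norm M p (\<lambda>\<omega>. Z \<omega> - forward_sum Y X n t \<omega>)
          \<le> 92 * I_fun (\<lambda>s t'. f s t' * of_bool (t' < s + 3 * mesh n t)) a b" .
    moreover have "t 0 = a" "t n = b" using part by (simp_all add: is_partition_def)
    ultimately show "Lp_norm M p (\<lambda>\<omega>. Z \<omega> - forward_sum Y X n t \<omega>)
          \<le> 92 * I_fun (\<lambda>s t'. f s t' * of_bool (t' < s + 3 * mesh n t)) (t 0) (t n)"
      by simp
  qed
qed

end
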